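(* Let $T'_n,T''_n$ be two independent copies of the uniformly random unrooted binary tree with leaf-set $[n]$, and let $M_n$ be the largest number of leaves in a rooted subtree shared by them, i.e. the largest cardinality $|S|$ of a set $S\subset[n]$, $1<|S|<n$, that induces the same rooted subtree in $T'_n$ and in $T''_n$ ($M_n:=1$ if there is none). Then $M_n\le(1+o(1))\,e\,2^{-1/2}n^{1/2}$ with probability tending to $1$; that is, for every $\varepsilon>0$, $$\lim_{n\to\infty}\mathbb P\bigl(M_n\le(1+\varepsilon)\,e\,2^{-1/2}\,n^{1/2}\bigr)=1.$$
   Context: $[n]=\{1,\dots,n\}$. An unrooted binary tree with leaf-set $[n]$ is a tree whose leaves (degree-1 vertices) are labelled bijectively by $[n]$ and all of whose other vertices have degree 3; trees are considered up to isomorphism preserving leaf labels. A rooted binary tree with leaf-set $S$ is a rooted tree whose leaves are labelled bijectively by $S$ and in which every non-leaf vertex has exactly two (unordered) children; such trees are considered up to isomorphism preserving the root and leaf labels. Rooted subtree induced by $S$ in an unrooted tree $T$ on $[n]$, where $1<|S|<n$: for each $S$ a leaf $\ell^*\in[n]\setminus S$ is fixed (an arbitrary choice, depending on $S$ only, the same for all trees $T$). Let $v$ be the vertex of $T$ adjacent to $\ell^*$. The paths from the leaves of $S$ to $v$, traced toward $v$, have a first common vertex $v^*$ (the first vertex lying on all $|S|$ of these paths). The union of the paths from $v^*$ to the leaves in $S$, rooted at $v^*$, with all its degree-2 vertices other than the root suppressed, is a rooted binary tree with leaf-set $S$, called the (rooted) tree induced by $S$ in $T$. *)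

theory Defs
  imports "HOL-Probability.Probability"
begin

type_synonym graph = "nat set \<times> nat set set"

type_synonym rooted_graph = "nat set \<times> nat set set \<times> nat"

definition simple_graph :: "nat set \<Rightarrow> nat set set \<Rightarrow> bool" where
  "simple_graph V E \<longleftrightarrow> finite V \<and> (\<forall>e\<in>E. e \<subseteq> V \<and> card e = 2)"

definition degree :: "nat set set \<Rightarrow> nat \<Rightarrow> nat" where
  "degree E v = card {e \<in> E. v \<in> e}"

definition is_path :: "nat set set \<Rightarrow> nat \<Rightarrow> nat list \<Rightarrow> nat \<Rightarrow> bool" where
  "is_path E u p w \<longleftrightarrow>
     p \<noteq> [] \<and> hd p = u \<and> last p = w \<and> distinct p \<and> successively (\<lambda>x y. {x, y} \<in> E) p"

definition is_tree :: "nat set \<Rightarrow> nat set set \<Rightarrow> bool" where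
  "is_tree V E \<longleftrightarrow>
     simple_graph V E \<and> V \<noteq> {} \<and> (\<forall>u\<in>V. \<forall>w\<in>V. \<exists>!p. is_path E u p w)"

definition tree_path :: "nat set set \<Rightarrow> nat \<Rightarrow> nat \<Rightarrow> nat list" where
  "tree_path E u w = (THE p. is_path E u p w)"

definition path_edges :: "nat list \<Rightarrow> nat set set" where
  "path_edges p = {{p ! i, p ! Suc i} | i. Suc i < length p}"

text \<open>The leaf labelled \<open>i\<close> is the vertex \<open>i\<close> itself; the names of the internal vertices are
  arbitrary and disappear in the isomorphism classes.\<close>

definition binary_tree_graphs :: "nat \<Rightarrow> graph set" where
  "binary_tree_graphs n = {(V, E). is_tree V E \<and>
     {v \<in> V. degree E v = 1} = {1..n} \<and> (\<forall>v \<in> V - {1..n}. degree E v = 3)}"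

definition graph_iso :: "nat set \<Rightarrow> graph \<Rightarrow> graph \<Rightarrow> bool" where
  "graph_iso L = (\<lambda>(V, E) (V', E').
     \<exists>f. bij_betw f V V' \<and> E' = (\<lambda>e. f ` e) ` E \<and> (\<forall>l\<in>L. f l = l))"

definition iso_rel :: "nat \<Rightarrow> (graph \<times> graph) set" where
  "iso_rel n = {(G, H). G \<in> binary_tree_graphs n \<and> H \<in> binary_tree_graphs n \<and>
     graph_iso {1..n} G H}"

definition unrooted_trees :: "nat \<Rightarrow> graph set set" where
  "unrooted_trees n = binary_tree_graphs n // iso_rel n"

definition uniform_tree :: "nat \<Rightarrow> graph set pmf" where
  "uniform_tree n = pmf_of_set (unrooted_trees n)"

text \<open>Throughout, \<open>l\<close> is the auxiliary leaf outside \<open>S\<close>.\<close>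

definition leaf_neighbour :: "nat set set \<Rightarrow> nat \<Rightarrow> nat" where
  "leaf_neighbour E l = (THE v. {l, v} \<in> E)"

text \<open>The common vertices of the paths from \<open>S\<close> to \<open>v\<close> are met in the same order by all
  these paths, so the first one does not depend on the path.\<close>

definition first_common_vertex :: "nat set set \<Rightarrow> nat set \<Rightarrow> nat \<Rightarrow> nat" where
  "first_common_vertex E S v = (THE x. \<forall>s\<in>S.
     find (\<lambda>y. \<forall>t\<in>S. y \<in> set (tree_path E t v)) (tree_path E s v) = Some x)"

text \<open>Suppressing the degree-2 vertices other than the root \<open>r\<close>: two of the remaining
  vertices become adjacent iff a path between them has only suppressed vertices inside.\<close>

definition suppress :: "rooted_graph \<Rightarrow> rooted_graph" where
  "suppress = (\<lambda>(W, F, r).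
     let K = {x \<in> W. x = r \<or> degree F x \<noteq> 2}
     in (K, {{x, y} | x y. x \<noteq> y \<and> (\<exists>p. is_path F x p y \<and> set p \<inter> K = {x, y})}, r))"

definition induced_rooted_graph :: "nat \<Rightarrow> nat set \<Rightarrow> graph \<Rightarrow> rooted_graph" where
  "induced_rooted_graph l S = (\<lambda>(V, E).
     let r = first_common_vertex E S (leaf_neighbour E l)
     in suppress (\<Union>s\<in>S. set (tree_path E r s), \<Union>s\<in>S. path_edges (tree_path E r s), r))"

definition rooted_iso :: "nat set \<Rightarrow> rooted_graph \<Rightarrow> rooted_graph \<Rightarrow> bool" where
  "rooted_iso L = (\<lambda>(V, E, r) (V', E', r').
     \<exists>f. bij_betw f V V' \<and> E' = (\<lambda>e. f ` e) ` E \<and> f r = r' \<and> (\<forall>l\<in>L. f l = l))"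

text \<open>The isomorphism class of the rooted tree induced by \<open>S\<close>; it is the same for all
  representatives \<open>G\<close> of the class \<open>T\<close>.\<close>

definition induced_rooted_tree :: "nat \<Rightarrow> nat set \<Rightarrow> graph set \<Rightarrow> rooted_graph set" where
  "induced_rooted_tree l S T = (\<Union>G\<in>T. {R. rooted_iso S (induced_rooted_graph l S G) R})"

text \<open>The function \<open>lstar\<close> chooses the auxiliary leaf. All sizes in the set below
  exceed 1, so inserting 1 only matters if there is no shared subtree.\<close>

definition max_common_subtree ::
  "(nat set \<Rightarrow> nat) \<Rightarrow> nat \<Rightarrow> graph set \<Rightarrow> graph set \<Rightarrow> nat" where
  "max_common_subtree lstar n T' T'' = Max (insert 1
     {card S | S. S \<subseteq> {1..n} \<and> 1 < card S \<and> card S < n \<and>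
        induced_rooted_tree (lstar S) S T' = induced_rooted_tree (lstar S) S T''})"

end

theory Submission
  imports Defs "HOL-Library.Sublist" "HOL-Library.Nat_Bijection" "HOL-Real_Asymp.Real_Asymp"
begin

text \<open>
The proof is a first-moment argument. Fix a set \<open>S\<close> of \<open>k\<close> leaves and its auxiliary leaf \<open>l\<close>. The
rooted tree induced by \<open>S\<close> is the restriction to \<open>S\<close> of the whole tree rooted at \<open>l\<close>, and in a
uniformly random tree it is uniformly distributed over the \<open>(2 k - 3)!!\<close> rooted binary trees on
\<open>S\<close>. So two independent trees share it with probability at most \<open>1 / (2 k - 3)!!\<close>, and a union bound
gives \<open>P (M\<^sub>n > t) \<le> (\<Sum>k>t. (n choose k) / (2 k - 3)!!)\<close>. Since \<open>k! (2 k - 1)!! = (2 k)! / 2\<^sup>k\<close> is at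
least \<open>(2 k\<^sup>2 / e\<^sup>2)\<^sup>k\<close>, the \<open>k\<close>-th term is at most \<open>2 k (n e\<^sup>2 / (2 k\<^sup>2))\<^sup>k\<close>, hence at most
\<open>2 k q\<^sup>k\<close> with \<open>q = 1 / (1 + \<epsilon>)\<^sup>2\<close> as soon as \<open>k\<close> exceeds \<open>t = (1 + \<epsilon>) e sqrt (n / 2)\<close>: the bound
is a tail of a convergent series.

Isomorphism classes are handled through clusters. Rooted at \<open>l\<close>, a tree is described by the family
of the sets of leaves below its vertices other than \<open>l\<close>. These families are exactly the binary
hierarchies on \<open>{1..n} - {l}\<close> (\<open>hier\<close>): a tree is recovered from its clusters up to isomorphism as
their Hasse diagram (\<open>clusters_eq_imp_iso\<close>), and every hierarchy arises (\<open>clusters_surj\<close>). In this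
language passing to the induced tree is the map \<open>C \<mapsto> C \<inter> S\<close> on clusters, without the empty set
(\<open>rooted_clusters_induced\<close>). The uniformity of the induced tree becomes the statement that all fibres
of this restriction map have the same size (\<open>card_restrict_fibre_mult\<close>), which follows by adding the
missing leaves one at a time: a new leaf can be attached above each of the \<open>2 m - 1\<close> clusters of a
hierarchy on \<open>m\<close> leaves, and every hierarchy with one more leaf arises in exactly one way.
\<close>

section \<open>Binary hierarchies\<close>

text \<open>A rooted binary tree with leaf set \<open>X\<close>, without names for its inner vertices: each vertex is
  represented by the set of leaves below it. Equality of such families is isomorphism of trees.\<close>

inductive hier :: "'a set \<Rightarrow> 'a set set \<Rightarrow> bool" where
  single: "hier {x} {{x}}"
| join: "hier A H \<Longrightarrow> hier B K \<Longrightarrow> A \<inter> B = {} \<Longrightarrow> hier (A \<union> B) (insert (A \<union> B) (H \<union> K))"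

lemma hier_finite: "hier X H \<Longrightarrow> finite X"
  by (induction rule: hier.induct) auto

lemma hier_nonempty: "hier X H \<Longrightarrow> X \<noteq> {}"
  by (induction rule: hier.induct) auto

lemma hier_top: "hier X H \<Longrightarrow> X \<in> H"
  by (induction rule: hier.induct) auto

lemma hier_subset: "hier X H \<Longrightarrow> C \<in> H \<Longrightarrow> C \<subseteq> X"
  by (induction rule: hier.induct) auto

lemma hier_member_nonempty: "hier X H \<Longrightarrow> C \<in> H \<Longrightarrow> C \<noteq> {}"
  by (induction rule: hier.induct) (auto dest: hier_nonempty)

lemma hier_finite_family: "hier X H \<Longrightarrow> finite H"
  by (induction rule: hier.induct) auto

lemma hier_singleton: "hier X H \<Longrightarrow> x \<in> X \<Longrightarrow> {x} \<in> H"
  by (induction rule: hier.induct) auto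

lemma hier_laminar:
  "hier X H \<Longrightarrow> C \<in> H \<Longrightarrow> D \<in> H \<Longrightarrow> C \<subseteq> D \<or> D \<subseteq> C \<or> C \<inter> D = {}"
proof (induction rule: hier.induct)
  case (join A H B K)
  have "E \<subseteq> A" if "E \<in> H" for E using hier_subset[OF join.hyps(1) that] .
  moreover have "E \<subseteq> B" if "E \<in> K" for E using hier_subset[OF join.hyps(2) that] .
  ultimately show ?case using join.IH join.prems join.hyps(3)
    by (elim UnE insertE) blast+
qed auto

lemma hier_split:
  "hier X H \<Longrightarrow> C \<in> H \<Longrightarrow> (\<exists>x. C = {x}) \<or>
    (\<exists>A\<in>H. \<exists>B\<in>H. C = A \<union> B \<and> A \<inter> B = {})"
proof (induction rule: hier.induct)
  case (join A H B K)
  have "A \<in> H" "B \<in> K" using join.hyps hier_top by auto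
  then show ?case using join by (elim UnE insertE) blast+
qed auto

lemma hier_single_iff: "hier {x} H \<longleftrightarrow> H = {{x}}"
proof
  assume h: "hier {x} H"
  have "C = {x}" if "C \<in> H" for C
    using hier_subset[OF h that] hier_member_nonempty[OF h that] by blast
  then show "H = {{x}}" using hier_top[OF h] by blast
qed (simp add: hier.single)

lemma hier_card: "hier X H \<Longrightarrow> card H = 2 * card X - 1"
proof (induction rule: hier.induct)
  case (join A H B K)
  note fin = hier_finite[OF join.hyps(1)] hier_finite[OF join.hyps(2)]
    hier_finite_family[OF join.hyps(1)] hier_finite_family[OF join.hyps(2)]
  note sub = hier_subset[OF join.hyps(1)] hier_subset[OF join.hyps(2)]
  note ne = hier_nonempty[OF join.hyps(1)] hier_nonempty[OF join.hyps(2)]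
  have "A \<union> B \<notin> H \<union> K"
    using sub ne join.hyps(3) by blast
  moreover have "H \<inter> K = {}"
    using sub hier_member_nonempty[OF join.hyps(1)] join.hyps(3) by blast
  moreover have "card A > 0" "card B > 0"
    using ne fin by (auto simp: card_gt_0_iff)
  ultimately show ?case
    using fin join.IH join.hyps(3) by (simp add: card_Un_disjoint)
qed auto

section \<open>Restriction of hierarchies and its fibres\<close>

text \<open>On trees this is the restriction to the leaves in \<open>S\<close>: vertices that lose a branch collapse
  with their remaining child because they have the same trace on \<open>S\<close>, so degree-2 vertices are
  suppressed automatically.\<close>

definition restrict_hier :: "'a set \<Rightarrow> 'a set set \<Rightarrow> 'a set set" where
  "restrict_hier S H = (\<lambda>C. C \<inter> S) ` H - {{}}"

lemma restrict_hier_iff: "C \<in> restrict_hier S H \<longleftrightarrow> C \<noteq> {} \<and> (\<exists>D\<in>H. C = D \<inter> S)"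
  by (auto simp: restrict_hier_def)

lemma restrict_hier_disjoint: "hier X H \<Longrightarrow> X \<inter> S = {} \<Longrightarrow> restrict_hier S H = {}"
  using hier_subset by (fastforce simp: restrict_hier_def)

lemma hier_restrict: "hier X H \<Longrightarrow> X \<inter> S \<noteq> {} \<Longrightarrow> hier (X \<inter> S) (restrict_hier S H)"
proof (induction rule: hier.induct)
  case (single x)
  then show ?case by (auto simp: restrict_hier_def hier.single)
next
  case (join A H B K)
  have eq: "restrict_hier S (insert (A \<union> B) (H \<union> K)) =
      insert ((A \<inter> S) \<union> (B \<inter> S)) (restrict_hier S H \<union> restrict_hier S K)"
    using join.prems by (auto simp: restrict_hier_def)
  have un: "(A \<union> B) \<inter> S = (A \<inter> S) \<union> (B \<inter> S)" by auto
  consider "A \<inter> S = {}" | "B \<inter> S = {}" | "A \<inter> S \<noteq> {}" "B \<inter> S \<noteq> {}" by blast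
  then show ?case
  proof cases
    case 1
    then have "hier (B \<inter> S) (restrict_hier S K)" "restrict_hier S H = {}"
      using join restrict_hier_disjoint[OF join.hyps(1)] by (simp_all add: Int_Un_distrib2)
    then show ?thesis
      unfolding eq un using 1 hier_top[of "B \<inter> S"] by (simp add: insert_absorb)
  next
    case 2
    then have "hier (A \<inter> S) (restrict_hier S H)" "restrict_hier S K = {}"
      using join restrict_hier_disjoint[OF join.hyps(2)] by (simp_all add: Int_Un_distrib2)
    then show ?thesis
      unfolding eq un using 2 hier_top[of "A \<inter> S"] by (simp add: insert_absorb)
  next
    case 3
    then show ?thesis unfolding eq un using join by (intro hier.join) auto
  qed
qed

lemma restrict_restrict: "S \<subseteq> Y \<Longrightarrow> restrict_hier S (restrict_hier Y H) = restrict_hier S H"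
proof -
  assume "S \<subseteq> Y"
  then have *: "C \<inter> Y \<inter> S = C \<inter> S" for C by auto
  show ?thesis
  proof (intro set_eqI iffI)
    fix C assume "C \<in> restrict_hier S (restrict_hier Y H)"
    then obtain E where "C \<noteq> {}" "E \<in> restrict_hier Y H" "C = E \<inter> S"
      unfolding restrict_hier_iff[of C] by blast
    then obtain D where "C \<noteq> {}" "D \<in> H" "C = D \<inter> Y \<inter> S"
      unfolding restrict_hier_iff by blast
    then show "C \<in> restrict_hier S H" unfolding restrict_hier_iff * by blast
  next
    fix C assume "C \<in> restrict_hier S H"
    then obtain D where D: "C \<noteq> {}" "D \<in> H" "C = D \<inter> Y \<inter> S"
      unfolding restrict_hier_iff * by auto
    then have "D \<inter> Y \<in> restrict_hier Y H" unfolding restrict_hier_iff by auto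
    then show "C \<in> restrict_hier S (restrict_hier Y H)"
      using D unfolding restrict_hier_iff[of C S "restrict_hier Y H"] by blast
  qed
qed

lemma restrict_hier_self: "hier X H \<Longrightarrow> restrict_hier X H = H"
proof -
  assume h: "hier X H"
  then have "C \<inter> X = C" "C \<noteq> {}" if "C \<in> H" for C
    using hier_subset[OF h that] hier_member_nonempty[OF h that] by auto
  then show ?thesis by (auto simp: restrict_hier_def image_iff)
qed

text \<open>The new leaf \<open>x\<close> is attached in the middle of the edge above the vertex \<open>C\<close> (above the root if
  \<open>C\<close> is the largest set). The set \<open>C\<close> itself remains and \<open>insert x C\<close> is the new inner vertex.\<close>

definition insert_leaf :: "'a \<Rightarrow> 'a set \<Rightarrow> 'a set set \<Rightarrow> 'a set set" where
  "insert_leaf x C H =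
    insert {x} (insert x ` {D \<in> H. C \<subseteq> D} \<union> {D \<in> H. \<not> C \<subset> D})"

lemma hier_insert_leaf:
  "hier Y H \<Longrightarrow> x \<notin> Y \<Longrightarrow> C \<in> H \<Longrightarrow> hier (insert x Y) (insert_leaf x C H)"
proof (induction rule: hier.induct)
  case (single y)
  have "insert_leaf x C {{y}} = insert ({x} \<union> {y}) ({{x}} \<union> {{y}})"
    using single by (auto simp: insert_leaf_def)
  moreover have "hier ({x} \<union> {y}) (insert ({x} \<union> {y}) ({{x}} \<union> {{y}}))"
    using single by (intro hier.intros) auto
  ultimately show ?case by (simp add: insert_commute)
next
  case (join A H B K)
  note sub = hier_subset[OF join.hyps(1)] hier_subset[OF join.hyps(2)]
  note nemp = hier_member_nonempty[OF join.hyps(1)] hier_member_nonempty[OF join.hyps(2)]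
  note ne = hier_nonempty[OF join.hyps(1)] hier_nonempty[OF join.hyps(2)]
  consider "C = A \<union> B" | "C \<in> H" | "C \<in> K" using join.prems by blast
  then show ?case
  proof cases
    case 1
    have no: "\<not> C \<subseteq> D" if "D \<in> H \<union> K" for D
      using that sub ne join.hyps(3) 1 by blast
    have a: "insert x ` {D \<in> insert (A \<union> B) (H \<union> K). C \<subseteq> D} = {insert x C}"
      using no 1 by auto
    have b: "{D \<in> insert (A \<union> B) (H \<union> K). \<not> C \<subset> D} = insert (A \<union> B) (H \<union> K)"
      using no 1 by auto
    have "insert_leaf x C (insert (A \<union> B) (H \<union> K)) =
        insert ({x} \<union> (A \<union> B)) ({{x}} \<union> insert (A \<union> B) (H \<union> K))"
      unfolding insert_leaf_def a b using 1 by auto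
    moreover have "hier ({x} \<union> (A \<union> B)) \<dots>"
      using join by (intro hier.intros) auto
    ultimately show ?thesis by simp
  next
    case 2
    have no: "\<not> C \<subseteq> D" if "D \<in> K" for D
      using that sub(2)[OF that] sub(1)[OF 2] nemp(1)[OF 2] join.hyps(3) by blast
    have CA: "C \<subset> A \<union> B" using sub(1)[OF 2] ne join.hyps(3) by blast
    have a: "insert x ` {D \<in> insert (A \<union> B) (H \<union> K). C \<subseteq> D} =
        insert (insert x (A \<union> B)) (insert x ` {D \<in> H. C \<subseteq> D})"
      using no CA by auto
    have b: "{D \<in> insert (A \<union> B) (H \<union> K). \<not> C \<subset> D} = {D \<in> H. \<not> C \<subset> D} \<union> K"
      using no CA by auto
    have "insert_leaf x C (insert (A \<union> B) (H \<union> K)) =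
        insert (insert x A \<union> B) (insert_leaf x C H \<union> K)"
      unfolding insert_leaf_def a b by auto
    moreover have "hier (insert x A \<union> B) \<dots>"
      using join 2 by (intro hier.intros) auto
    ultimately show ?thesis by simp
  next
    case 3
    have no: "\<not> C \<subseteq> D" if "D \<in> H" for D
      using that sub(1)[OF that] sub(2)[OF 3] nemp(2)[OF 3] join.hyps(3) by blast
    have CA: "C \<subset> A \<union> B" using sub(2)[OF 3] ne join.hyps(3) by blast
    have a: "insert x ` {D \<in> insert (A \<union> B) (H \<union> K). C \<subseteq> D} =
        insert (insert x (A \<union> B)) (insert x ` {D \<in> K. C \<subseteq> D})"
      using no CA by auto
    have b: "{D \<in> insert (A \<union> B) (H \<union> K). \<not> C \<subset> D} = H \<union> {D \<in> K. \<not> C \<subset> D}"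
      using no CA by auto
    have "insert_leaf x C (insert (A \<union> B) (H \<union> K)) =
        insert (A \<union> insert x B) (H \<union> insert_leaf x C K)"
      unfolding insert_leaf_def a b by auto
    moreover have "hier (A \<union> insert x B) \<dots>"
      using join 3 by (intro hier.intros) auto
    ultimately show ?thesis by simp
  qed
qed

lemma restrict_insert_leaf:
  assumes "hier Y H" "x \<notin> Y" "C \<in> H"
  shows "restrict_hier Y (insert_leaf x C H) = H"
proof -
  have 1: "insert x D \<inter> Y = D" "D \<inter> Y = D" "D \<noteq> {}" if "D \<in> H" for D
    using hier_subset[OF assms(1) that] hier_member_nonempty[OF assms(1) that] assms(2) by auto
  have 2: "{x} \<inter> Y = {}" using assms by auto
  show ?thesis
  proof (intro set_eqI iffI)
    fix D assume "D \<in> restrict_hier Y (insert_leaf x C H)"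
    then obtain E where E: "D \<noteq> {}" "E \<in> insert_leaf x C H" "D = E \<inter> Y"
      unfolding restrict_hier_iff by blast
    from E(2) consider "E = {x}" | F where "F \<in> H" "E = insert x F" | "E \<in> H"
      unfolding insert_leaf_def by blast
    then show "D \<in> H" using E 1 2 by cases auto
  next
    fix D assume D: "D \<in> H"
    show "D \<in> restrict_hier Y (insert_leaf x C H)"
    proof (cases "C \<subset> D")
      case True
      then have "insert x D \<in> insert_leaf x C H" using D by (auto simp: insert_leaf_def)
      then show ?thesis unfolding restrict_hier_iff using 1[OF D] by metis
    next
      case False
      then have "D \<in> insert_leaf x C H" using D by (auto simp: insert_leaf_def)
      then show ?thesis unfolding restrict_hier_iff using 1[OF D] by metis
    qed
  qed
qed

text \<open>The place of attachment is recovered as the smallest set that occurs together with \<open>x\<close>: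
  the nonsingleton members containing \<open>x\<close> are the sets \<open>insert x D\<close> with \<open>C \<subseteq> D\<close>.\<close>

lemma insert_leaf_inj:
  assumes "hier Y H" "x \<notin> Y" "C \<in> H" "D \<in> H" "insert_leaf x C H = insert_leaf x D H"
  shows "C = D"
proof -
  have *: "D \<subseteq> C" if "C \<in> H" "D \<in> H" "insert_leaf x C H = insert_leaf x D H" for C D
  proof -
    have "insert x C \<in> insert_leaf x C H" using that(1) by (auto simp: insert_leaf_def)
    then have "insert x C \<in> insert_leaf x D H" unfolding that(3) .
    moreover have C: "C \<noteq> {}" "x \<notin> C"
      using hier_member_nonempty[OF assms(1) that(1)] hier_subset[OF assms(1) that(1)] assms(2)
      by auto
    moreover have "x \<notin> E" if "E \<in> H" for E using hier_subset[OF assms(1) that] assms(2) by auto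
    ultimately obtain F where "F \<in> H" "D \<subseteq> F" "insert x C = insert x F" "x \<notin> F"
      unfolding insert_leaf_def by blast
    then show ?thesis using C by (metis insert_ident)
  qed
  show ?thesis
    using *[OF assms(3,4,5)] *[OF assms(4,3) assms(5)[symmetric]] by (rule subset_antisym[rotated])
qed

text \<open>Conversely, in the tree of \<open>K\<close> the leaf \<open>x\<close> has a sibling, and \<open>x\<close> was attached above it. The
  induction follows the path from the root to \<open>x\<close>; it ends when \<open>{x}\<close> is one of the two parts.\<close>

lemma hier_eq_insert_leaf:
  "hier X K \<Longrightarrow> x \<in> X \<Longrightarrow> X \<noteq> {x} \<Longrightarrow>
    \<exists>C\<in>restrict_hier (X - {x}) K. K = insert_leaf x C (restrict_hier (X - {x}) K)"
proof -
  have "\<exists>Y H C. hier Y H \<and> C \<in> H \<and> x \<notin> Y \<and> X = insert x Y \<and> K = insert_leaf x C H"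
    if "hier X K" "x \<in> X" "X \<noteq> {x}"
    using that
  proof (induction rule: hier.induct)
    case (join A H B K)
    have *: "\<exists>Y H' C. hier Y H' \<and> C \<in> H' \<and> x \<notin> Y \<and> A \<union> B = insert x Y
          \<and> insert (A \<union> B) (H \<union> K) = insert_leaf x C H'"
      if h: "hier A H" "hier B K" and d: "A \<inter> B = {}" and xA: "x \<in> A"
        and IH: "A \<noteq> {x} \<Longrightarrow> \<exists>Y H' C. hier Y H' \<and> C \<in> H' \<and> x \<notin> Y \<and> A = insert x Y
          \<and> H = insert_leaf x C H'" for A B H K
    proof (cases "A = {x}")
      case True
      then have H: "H = {{x}}" using h hier_single_iff[of x H] by simp
      have "\<not> B \<subset> D" "B \<subseteq> D \<longleftrightarrow> D = B" if "D \<in> K" for D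
        using hier_subset[OF h(2) that] by auto
      then have "insert_leaf x B K = insert {x} (insert x ` {B} \<union> K)"
        unfolding insert_leaf_def using hier_top[OF h(2)] by blast
      then have "insert (A \<union> B) (H \<union> K) = insert_leaf x B K"
        unfolding H True by auto
      moreover have "x \<notin> B" using xA d by auto
      ultimately show ?thesis using h hier_top[OF h(2)] True by auto
    next
      case False
      then obtain Y H' C where Y: "hier Y H'" "C \<in> H'" "x \<notin> Y" "A = insert x Y"
        "H = insert_leaf x C H'" using IH by blast
      have dj: "Y \<inter> B = {}" "x \<notin> B" using Y d by auto
      have C: "C \<subseteq> Y" "C \<noteq> {}"
        using hier_subset[OF Y(1,2)] hier_member_nonempty[OF Y(1,2)] by auto
      have no: "\<not> C \<subseteq> D" if "D \<in> K" for D using hier_subset[OF h(2) that] C dj by blast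
      have CA: "C \<subset> Y \<union> B" using C dj hier_nonempty[OF h(2)] by blast
      have a: "insert x ` {D \<in> insert (Y \<union> B) (H' \<union> K). C \<subseteq> D} =
          insert (insert x (Y \<union> B)) (insert x ` {D \<in> H'. C \<subseteq> D})"
        using no CA by auto
      have b: "{D \<in> insert (Y \<union> B) (H' \<union> K). \<not> C \<subset> D} = {D \<in> H'. \<not> C \<subset> D} \<union> K"
        using no CA by auto
      have "insert (A \<union> B) (H \<union> K) = insert_leaf x C (insert (Y \<union> B) (H' \<union> K))"
        unfolding Y insert_leaf_def a b by auto
      moreover have "hier (Y \<union> B) (insert (Y \<union> B) (H' \<union> K))"
        using Y h dj by (intro hier.join) auto
      ultimately show ?thesis using Y dj
        by (intro exI[of _ "Y \<union> B"] exI[of _ "insert (Y \<union> B) (H' \<union> K)"] exI[of _ C]) auto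
    qed
    show ?case
    proof (cases "x \<in> A")
      case True
      then show ?thesis using *[OF join.hyps(1,2,3) True] join.IH(1) by blast
    next
      case False
      then have xB: "x \<in> B" using join.prems by auto
      have "B \<inter> A = {}" using join.hyps by auto
      from *[OF join.hyps(2,1) this xB] join.IH(2) xB
      show ?thesis by (simp add: Un_commute)
    qed
  qed auto
  note * = this
  assume "hier X K" "x \<in> X" "X \<noteq> {x}"
  from *[OF this] obtain Y H C where Y: "hier Y H" "C \<in> H" "x \<notin> Y" "X = insert x Y"
    "K = insert_leaf x C H" by blast
  moreover have "X - {x} = Y" using Y by auto
  ultimately show ?thesis using restrict_insert_leaf[OF Y(1,3,2)] by auto
qed

lemma finite_hiers: "finite X \<Longrightarrow> finite {H. hier X H}"
proof (rule finite_subset)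
  show "{H. hier X H} \<subseteq> Pow (Pow X)" using hier_subset by blast
qed simp

text \<open>The double factorial \<open>(2 k - 3)!!\<close>.\<close>

definition num_hier :: "nat \<Rightarrow> nat" where
  "num_hier k = (\<Prod>m\<in>{1..<k}. 2 * m - 1)"

lemma card_restrict_fibre:
  assumes "hier S h" "finite Z" "S \<inter> Z = {}"
  shows "card {H. hier (S \<union> Z) H \<and> restrict_hier S H = h} =
    (\<Prod>m\<in>{card S..<card (S \<union> Z)}. 2 * m - 1)"
  using assms(2,3)
proof (induction Z rule: finite_induct)
  case empty
  have "{H. hier (S \<union> {}) H \<and> restrict_hier S H = h} = {h}"
    using assms(1) restrict_hier_self by auto
  then show ?case by simp
next
  case (insert x Z)
  define Y where "Y = S \<union> Z"
  have fS: "finite S" using hier_finite[OF assms(1)] .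
  have Y: "finite Y" "x \<notin> Y" "S \<subseteq> Y" "Y \<noteq> {}" "card S \<le> card Y"
    using insert fS hier_nonempty[OF assms(1)] by (auto simp: Y_def intro: card_mono)
  let ?F = "{H. hier Y H \<and> restrict_hier S H = h}"
  \<comment> \<open>A tree with the leaf \<open>x\<close> is a tree without it and a choice of an edge for \<open>x\<close>.\<close>
  have eq: "{H. hier (insert x Y) H \<and> restrict_hier S H = h} =
      (\<lambda>(H, C). insert_leaf x C H) ` (SIGMA H:?F. H)" (is "?L = ?R")
  proof (rule set_eqI, rule iffI)
    fix K assume "K \<in> ?L"
    then have K: "hier (insert x Y) K" "restrict_hier S K = h" by auto
    obtain C where C: "C \<in> restrict_hier Y K" "K = insert_leaf x C (restrict_hier Y K)"
      using hier_eq_insert_leaf[OF K(1), of x] Y by auto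
    have "hier (insert x Y \<inter> Y) (restrict_hier Y K)" using K Y by (intro hier_restrict) auto
    moreover have "insert x Y \<inter> Y = Y" by auto
    ultimately have "restrict_hier Y K \<in> ?F" using restrict_restrict[OF Y(3)] K by auto
    then show "K \<in> ?R" using C by (intro image_eqI[of _ _ "(restrict_hier Y K, C)"]) auto
  next
    fix K assume "K \<in> ?R"
    then obtain H C where H: "hier Y H" "restrict_hier S H = h" "C \<in> H" "K = insert_leaf x C H"
      by auto
    then show "K \<in> ?L"
      using hier_insert_leaf[OF H(1) Y(2) H(3)] restrict_insert_leaf[OF H(1) Y(2) H(3)]
        restrict_restrict[OF Y(3), of "insert_leaf x C H"] by simp
  qed
  have inj: "inj_on (\<lambda>(H, C). insert_leaf x C H) (SIGMA H:?F. H)"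
  proof (rule inj_onI, clarsimp)
    fix H C H' C'
    assume a: "hier Y H" "C \<in> H" "hier Y H'" "C' \<in> H'" "insert_leaf x C H = insert_leaf x C' H'"
    then have "H = H'" using restrict_insert_leaf Y(2) by metis
    then show "H = H' \<and> C = C'" using a insert_leaf_inj Y(2) by metis
  qed
  have "finite ?F" using finite_hiers[OF Y(1)] by (rule rev_finite_subset) auto
  then have "card ?L = (\<Sum>H\<in>?F. card H)"
    unfolding eq card_image[OF inj] by (intro card_SigmaI) (use hier_finite_family in auto)
  also have "\<dots> = (\<Sum>H\<in>?F. 2 * card Y - 1)"
    using hier_card by (intro sum.cong) auto
  also have "\<dots> = (\<Prod>m\<in>{card S..<card Y}. 2 * m - 1) * (2 * card Y - 1)"
    using insert by (simp add: Y_def)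
  also have "\<dots> = (\<Prod>m\<in>{card S..<card (insert x Y)}. 2 * m - 1)"
    using Y by (simp add: prod.atLeastLessThan_Suc)
  finally show ?case by (simp add: Y_def)
qed

lemma card_hiers:
  assumes "finite X" "X \<noteq> {}"
  shows "card {H. hier X H} = num_hier (card X)"
proof -
  obtain x where x: "x \<in> X" using assms(2) by blast
  have X: "{x} \<union> (X - {x}) = X" using x by blast
  have "restrict_hier {x} H = {{x}}" if "hier X H" for H
    using hier_restrict[OF that, of "{x}"] x hier_single_iff[of x "restrict_hier {x} H"]
    by (simp add: Int_absorb1)
  then have "{H. hier X H} = {H. hier X H \<and> restrict_hier {x} H = {{x}}}" by blast
  moreover have "card \<dots> = (\<Prod>m\<in>{1..<card X}. 2 * m - 1)"
    using card_restrict_fibre[OF hier.single[of x], of "X - {x}"] assms(1) unfolding X by simp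
  ultimately show ?thesis by (simp add: num_hier_def)
qed

text \<open>The restriction to \<open>S\<close> of a uniformly random hierarchy on \<open>X\<close> is uniform.\<close>

lemma card_restrict_fibre_mult:
  assumes "hier S h" "finite X" "S \<subseteq> X"
  shows "card {H. hier X H \<and> restrict_hier S H = h} * num_hier (card S) = card {H. hier X H}"
proof -
  have X: "S \<union> (X - S) = X" using assms by auto
  have S: "S \<noteq> {}" "finite S" using hier_nonempty hier_finite assms by auto
  then have "1 \<le> card S" by (simp add: Suc_leI card_gt_0_iff)
  moreover have "card S \<le> card X" using assms by (intro card_mono)
  ultimately have "num_hier (card X) = num_hier (card S) * (\<Prod>m\<in>{card S..<card X}. 2 * m - 1)"
    unfolding num_hier_def by (simp add: prod.atLeastLessThan_concat)
  moreover have "X \<noteq> {}" using S assms by auto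
  moreover have "card {H. hier X H \<and> restrict_hier S H = h} =
      (\<Prod>m\<in>{card S..<card X}. 2 * m - 1)"
    using card_restrict_fibre[OF assms(1), of "X - S"] assms unfolding X by simp
  ultimately show ?thesis
    using card_hiers[of X] assms(2) by simp
qed

section \<open>Paths in trees\<close>

lemma is_path_singleton [simp]: "is_path E u [x] w \<longleftrightarrow> u = x \<and> w = x"
  by (auto simp: is_path_def)

lemma is_path_same: "is_path E u p u \<Longrightarrow> p = [u]"
  by (cases p) (auto simp: is_path_def split: if_splits)

lemma is_path_rev: "is_path E u p w \<Longrightarrow> is_path E w (rev p) u"
  by (auto simp: is_path_def hd_rev last_rev insert_commute)

lemma is_path_appendD:
  assumes "is_path E u (p @ y # q) w"
  shows "is_path E u (p @ [y]) y" "is_path E y (y # q) w"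
  using assms by (auto simp: is_path_def successively_append_iff hd_append split: if_splits)

lemma is_path_snoc:
  assumes "is_path E u p w" "{w, x} \<in> E" "x \<notin> set p"
  shows "is_path E u (p @ [x]) x"
  using assms by (auto simp: is_path_def successively_append_iff)

lemma is_path_mono:
  assumes "is_path E u p w" "\<And>x y. {x, y} \<in> E \<Longrightarrow> x \<in> set p \<Longrightarrow> y \<in> set p \<Longrightarrow> {x, y} \<in> E'"
  shows "is_path E' u p w"
  using assms unfolding is_path_def by (auto intro: successively_mono)

lemma is_path_map:
  assumes "is_path E u p w" "inj_on f (set p)"
  shows "is_path ((\<lambda>e. f ` e) ` E) (f u) (map f p) (f w)"
proof -
  have "{f x, f y} \<in> (\<lambda>e. f ` e) ` E" if "{x, y} \<in> E" for x y
    using imageI[OF that, of "\<lambda>e. f ` e"] by simp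
  then have "successively (\<lambda>x y. {f x, f y} \<in> (\<lambda>e. f ` e) ` E) p"
    using assms(1) unfolding is_path_def by (auto intro: successively_mono)
  then show ?thesis
    using assms by (auto simp: is_path_def successively_map hd_map last_map distinct_map)
qed

lemma is_path_path_edges:
  assumes "is_path E u p w"
  shows "is_path (path_edges p) u p w" "path_edges p \<subseteq> E"
proof -
  have "\<forall>i. Suc i < length p \<longrightarrow> {p ! i, p ! Suc i} \<in> E"
    using assms by (simp add: is_path_def successively_conv_nth)
  then show "path_edges p \<subseteq> E" by (auto simp: path_edges_def)
  show "is_path (path_edges p) u p w"
    using assms by (auto simp: is_path_def successively_conv_nth path_edges_def)
qed

lemma path_edges_append_pair: "{x, y} \<in> path_edges (p @ x # y # q)"
  unfolding path_edges_def
  by (rule CollectI, rule exI[of _ "length p"]) (simp add: nth_append)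

section \<open>Rooted trees\<close>

locale tree =
  fixes V :: "nat set" and E :: "nat set set"
  assumes tree: "is_tree V E"
begin

lemma finite_V: "finite V"
  using tree by (simp add: is_tree_def simple_graph_def)

lemma edge_in_V: "{x, y} \<in> E \<Longrightarrow> x \<in> V \<and> y \<in> V \<and> x \<noteq> y"
  using tree unfolding is_tree_def simple_graph_def
  by (metis card_2_iff doubleton_eq_iff empty_subsetI insert_absorb2 insert_subset)

lemma edge_cases: "e \<in> E \<Longrightarrow> \<exists>x y. e = {x, y} \<and> x \<in> V \<and> y \<in> V"
  using tree unfolding is_tree_def simple_graph_def by (metis card_2_iff insert_subset)

lemma edge_at: "e \<in> E \<Longrightarrow> v \<in> e \<Longrightarrow> \<exists>y. e = {v, y}"
  using edge_cases[of e] by (auto simp: insert_commute)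

lemma path_in_V:
  assumes "is_path E u p w" "u \<in> V" shows "set p \<subseteq> V"
  using assms
proof (induction p arbitrary: u)
  case (Cons x p)
  show ?case
  proof (cases p)
    case (Cons y q)
    then have "{x, y} \<in> E" "is_path E y p w"
      using Cons.prems by (auto simp: is_path_def)
    then show ?thesis using Cons.IH[of y] edge_in_V by auto
  qed (use Cons.prems in \<open>auto simp: is_path_def\<close>)
qed simp

lemma tree_path_is_path: "u \<in> V \<Longrightarrow> w \<in> V \<Longrightarrow> is_path E u (tree_path E u w) w"
  using tree unfolding is_tree_def tree_path_def by (metis theI')

lemma tree_path_eqI: "u \<in> V \<Longrightarrow> w \<in> V \<Longrightarrow> is_path E u p w \<Longrightarrow> tree_path E u w = p"
  using tree unfolding is_tree_def tree_path_def by (metis the1_equality)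

end

locale rooted_tree = tree +
  fixes l :: nat
  assumes root_in_V: "l \<in> V"
begin

text \<open>By uniqueness of paths, \<open>y\<close> lies on the path from the root to \<open>x\<close> if and only if the path to \<open>y\<close>
  is a prefix of the path to \<open>x\<close> (\<open>le_alt\<close>). So the ancestor order is the prefix order on lists, and
  all its properties are inherited from there.\<close>

definition P :: "nat \<Rightarrow> nat list" where "P x = tree_path E l x"

definition le :: "nat \<Rightarrow> nat \<Rightarrow> bool" where
  "le x y \<longleftrightarrow> x \<in> V \<and> y \<in> set (P x)"

definition child :: "nat \<Rightarrow> nat \<Rightarrow> bool" where
  "child v c \<longleftrightarrow> v \<in> V \<and> c \<in> V \<and> P c = P v @ [c]"

lemma P_path: "x \<in> V \<Longrightarrow> is_path E l (P x) x"
  unfolding P_def using root_in_V tree_path_is_path by auto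

lemma P_eqI: "x \<in> V \<Longrightarrow> is_path E l p x \<Longrightarrow> P x = p"
  unfolding P_def using root_in_V tree_path_eqI by auto

lemma P_root [simp]: "P l = [l]"
  using P_eqI root_in_V by simp

lemma P_last: "x \<in> V \<Longrightarrow> last (P x) = x"
  and P_hd: "x \<in> V \<Longrightarrow> hd (P x) = l"
  and P_nonempty: "x \<in> V \<Longrightarrow> P x \<noteq> []"
  and P_distinct: "x \<in> V \<Longrightarrow> distinct (P x)"
  using P_path[of x] by (auto simp: is_path_def)

lemma P_in_V: "x \<in> V \<Longrightarrow> set (P x) \<subseteq> V"
  using path_in_V[OF P_path root_in_V] .

lemma P_inj: "x \<in> V \<Longrightarrow> y \<in> V \<Longrightarrow> P x = P y \<Longrightarrow> x = y"
  using P_last by metis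

lemma P_split: "x \<in> V \<Longrightarrow> P x = p @ y # q \<Longrightarrow> P y = p @ [y]"
proof -
  assume x: "x \<in> V" and *: "P x = p @ y # q"
  then have "y \<in> V" using P_in_V[OF x] by auto
  then show "P y = p @ [y]"
    using P_path[OF x] unfolding * by (intro P_eqI is_path_appendD)
qed

lemma le_in_V: "le x y \<Longrightarrow> x \<in> V \<and> y \<in> V"
  using P_in_V by (auto simp: le_def)

lemma le_iff_prefix: "x \<in> V \<Longrightarrow> y \<in> V \<Longrightarrow> le x y \<longleftrightarrow> prefix (P y) (P x)"
proof
  assume "x \<in> V" "y \<in> V" "le x y"
  then obtain p q where *: "P x = p @ y # q"
    unfolding le_def by (metis split_list)
  then show "prefix (P y) (P x)" using P_split[OF \<open>x \<in> V\<close> *] by auto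
next
  assume "x \<in> V" "y \<in> V" "prefix (P y) (P x)"
  moreover have "y \<in> set (P y)"
    using P_last[OF \<open>y \<in> V\<close>] P_nonempty[OF \<open>y \<in> V\<close>] last_in_set by metis
  ultimately show "le x y" unfolding le_def using set_mono_prefix by blast
qed

lemma le_refl: "x \<in> V \<Longrightarrow> le x x"
  by (simp add: le_iff_prefix)

lemma le_root: "x \<in> V \<Longrightarrow> le x l"
  unfolding le_def using P_hd P_nonempty hd_in_set by metis

lemma le_alt: "le x y \<longleftrightarrow> x \<in> V \<and> y \<in> V \<and> prefix (P y) (P x)"
  using le_in_V le_iff_prefix by blast

lemma le_trans: "le x y \<Longrightarrow> le y z \<Longrightarrow> le x z"
  unfolding le_alt by auto

lemma le_antisym: "le x y \<Longrightarrow> le y x \<Longrightarrow> x = y"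
  unfolding le_alt using P_inj prefix_order.antisym by blast

lemma le_comparable: "le x y \<Longrightarrow> le x z \<Longrightarrow> le y z \<or> le z y"
  unfolding le_alt using prefix_same_cases by blast

lemma le_length: "le x y \<Longrightarrow> x \<noteq> y \<Longrightarrow> length (P y) < length (P x)"
  unfolding le_alt using P_inj prefix_length_less prefix_order.le_neq_trans by blast

lemma child_le: "child v c \<Longrightarrow> le c v"
  by (auto simp: child_def le_iff_prefix)

lemma child_neq: "child v c \<Longrightarrow> c \<noteq> v"
  by (auto simp: child_def)

lemma child_edge: "child v c \<Longrightarrow> {v, c} \<in> E"
proof -
  assume c: "child v c"
  then have "is_path E l (P v @ [c]) c" "P v \<noteq> []" "last (P v) = v"
    using P_path[of c] P_nonempty P_last by (auto simp: child_def)
  then show ?thesis by (auto simp: is_path_def successively_append_iff)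
qed

lemma edge_child: "{x, y} \<in> E \<Longrightarrow> child x y \<or> child y x"
proof -
  assume e: "{x, y} \<in> E"
  then have V: "x \<in> V" "y \<in> V" "x \<noteq> y" using edge_in_V by auto
  show ?thesis
  proof (cases "y \<in> set (P x)")
    case False
    then have "P y = P x @ [y]"
      using V e P_path by (intro P_eqI is_path_snoc[of E l _ x]) auto
    then show ?thesis using V by (simp add: child_def)
  next
    case True
    then have "le x y" using V by (simp add: le_def)
    then have "\<not> le y x" using V le_antisym by auto
    then have "x \<notin> set (P y)" using V by (simp add: le_def)
    then have "P x = P y @ [x]"
      using V e P_path by (intro P_eqI is_path_snoc[of E l _ y]) (auto simp: insert_commute)
    then show ?thesis using V by (simp add: child_def)
  qed
qed

lemma below_child: "le x v \<Longrightarrow> x \<noteq> v \<Longrightarrow> \<exists>c. child v c \<and> le x c"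
proof -
  assume "le x v" "x \<noteq> v"
  then have V: "x \<in> V" "v \<in> V" "prefix (P v) (P x)" "P v \<noteq> P x"
    unfolding le_alt using P_inj by auto
  then obtain r where r: "P x = P v @ r" by (auto elim: prefixE)
  with V obtain c q where "r = c # q" by (cases r) auto
  with r have *: "P x = P v @ c # q" by simp
  then have "P c = P v @ [c]" "c \<in> V" using P_split[OF V(1) *] P_in_V[OF V(1)] by auto
  then show ?thesis using * V by (intro exI[of _ c]) (auto simp: child_def le_def)
qed

lemma parent_exists: "v \<in> V \<Longrightarrow> v \<noteq> l \<Longrightarrow> \<exists>u. child u v"
proof -
  assume v: "v \<in> V" "v \<noteq> l"
  obtain p where p: "P v = p @ [v]"
    using P_last[OF v(1)] append_butlast_last_id[OF P_nonempty[OF v(1)]] by metis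
  have "p \<noteq> []" using P_hd[OF v(1)] v p by (auto)
  then obtain p' u where u: "p = p' @ [u]" by (metis rev_exhaust)
  then have "P v = p' @ u # [v]" using p by simp
  then have "P u = p" "u \<in> V" using P_split[OF v(1)] u P_in_V[OF v(1)] by auto
  then show ?thesis using p v by (auto simp: child_def)
qed

lemma parent_unique: "child u v \<Longrightarrow> child w v \<Longrightarrow> u = w"
  unfolding child_def using P_inj by auto

lemma child_not_root: "\<not> child u l"
  using P_nonempty by (auto simp: child_def)

lemma children_incomparable: "child v c \<Longrightarrow> child v d \<Longrightarrow> le x c \<Longrightarrow> le x d \<Longrightarrow> c = d"
proof -
  assume *: "child v c" "child v d" "le x c" "le x d"
  then have "le c d \<or> le d c" using le_comparable by auto
  moreover have "length (P c) = length (P d)" using * by (simp add: child_def)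
  ultimately show ?thesis using le_length by fastforce
qed

lemma le_child_iff: "child v c \<Longrightarrow> le c y \<longleftrightarrow> y = c \<or> le v y"
  by (auto simp: le_def child_def)

lemma child_rigid: "child v c \<Longrightarrow> le c y \<Longrightarrow> le y v \<Longrightarrow> y = c \<or> y = v"
  using le_child_iff le_antisym by blast

lemma finite_children: "finite {c. child v c}"
  using finite_V by (rule rev_finite_subset) (auto simp: child_def)

lemma card_down_edges: "card ((\<lambda>c. {v, c}) ` {c. child v c}) = card {c. child v c}"
  by (rule card_image) (auto simp: inj_on_def doubleton_eq_iff)

lemma edges_at_root: "{e \<in> E. l \<in> e} = (\<lambda>c. {l, c}) ` {c. child l c}"
proof (intro equalityI subsetI)
  fix e assume "e \<in> {e \<in> E. l \<in> e}"
  then obtain y where y: "e = {l, y}" "{l, y} \<in> E" using edge_at[of e l] by auto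
  then have "child l y" using edge_child[OF y(2)] child_not_root by simp
  then show "e \<in> (\<lambda>c. {l, c}) ` {c. child l c}" using y by auto
qed (use child_edge in auto)

lemma edges_at:
  assumes "child u v"
  shows "{e \<in> E. v \<in> e} = insert {u, v} ((\<lambda>c. {v, c}) ` {c. child v c})"
proof (intro equalityI subsetI)
  fix e assume "e \<in> {e \<in> E. v \<in> e}"
  then obtain y where y: "e = {v, y}" "{v, y} \<in> E" using edge_at[of e v] by auto
  then have "child v y \<or> child y v" using edge_child[OF y(2)] by simp
  then show "e \<in> insert {u, v} ((\<lambda>c. {v, c}) ` {c. child v c})"
    using y parent_unique[OF assms] by auto
qed (use child_edge assms in auto)

lemma degree_root: "degree E l = card {c. child l c}"
  unfolding degree_def edges_at_root card_down_edges ..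

lemma degree_nonroot: "child u v \<Longrightarrow> degree E v = Suc (card {c. child v c})"
proof -
  assume u: "child u v"
  have "{u, v} \<notin> (\<lambda>c. {v, c}) ` {c. child v c}"
  proof
    assume "{u, v} \<in> (\<lambda>c. {v, c}) ` {c. child v c}"
    then have "child v u" using child_neq[OF u] by (auto simp: doubleton_eq_iff)
    then have "u = v" using u child_le le_antisym by blast
    then show False using child_neq[OF u] by simp
  qed
  then show ?thesis
    unfolding degree_def edges_at[OF u] using finite_children card_down_edges by simp
qed

text \<open>Leaving the part of the tree below \<open>v\<close> is only possible through \<open>v\<close>.\<close>

lemma edge_crossing:
  assumes "{a, b} \<in> E" "le a v" "\<not> le b v" shows "a = v"
proof -
  have "child a b \<or> child b a" using assms edge_child by auto
  then show ?thesis
  proof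
    assume "child a b"
    then show ?thesis using assms child_le le_trans by blast
  next
    assume "child b a"
    then show ?thesis using assms(2,3) le_child_iff[of b a v] by simp
  qed
qed

lemma path_crossing:
  assumes "is_path E x p y" "\<not> le x v" "le y v" shows "v \<in> set p"
  using assms
proof (induction p arbitrary: x)
  case (Cons a p)
  then have a: "a = x" by (simp add: is_path_def)
  show ?case
  proof (cases p)
    case (Cons b q)
    then have e: "{b, a} \<in> E" "is_path E b p y"
      using Cons.prems by (auto simp: is_path_def insert_commute)
    then show ?thesis using Cons.IH[of b] Cons.prems edge_crossing[OF e(1), of v] Cons a by auto
  qed (use Cons.prems in \<open>auto simp: is_path_def\<close>)
qed (simp add: is_path_def)

lemma path_down:
  assumes "le x y" shows "\<exists>p q. P y = p @ [y] \<and> P x = p @ y # q \<and> tree_path E y x = y # q"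
proof -
  have V: "x \<in> V" "y \<in> V" using le_in_V assms by auto
  then obtain p q where *: "P x = p @ y # q" using assms split_list unfolding le_def by fast
  have "P y = p @ [y]" using P_split[OF V(1) *] .
  moreover have "is_path E y (y # q) x" using P_path[OF V(1)] unfolding * by (rule is_path_appendD)
  ultimately show ?thesis using * tree_path_eqI[OF V(2,1)] by blast
qed

end

section \<open>Clusters of a binary tree\<close>

definition cluster :: "nat \<Rightarrow> nat \<Rightarrow> nat set set \<Rightarrow> nat \<Rightarrow> nat set" where
  "cluster n l E v = {i \<in> {1..n}. v \<in> set (tree_path E l i)}"

text \<open>The root \<open>l\<close> is left out because it is itself a leaf and would only contribute the set of all
  leaves; the remaining vertices form a rooted binary tree on the other leaves.\<close>

definition clusters :: "nat \<Rightarrow> nat \<Rightarrow> graph \<Rightarrow> nat set set" where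
  "clusters n l = (\<lambda>(V, E). cluster n l E ` (V - {l}))"

locale leaf_rooted =
  fixes V :: "nat set" and E :: "nat set set" and n l :: nat
  assumes btg: "(V, E) \<in> binary_tree_graphs n"
    and root_leaf: "l \<in> {1..n}" and n2: "2 \<le> n"
begin

lemma leaves: "{v \<in> V. degree E v = 1} = {1..n}"
  and inner_degree: "v \<in> V \<Longrightarrow> v \<notin> {1..n} \<Longrightarrow> degree E v = 3"
  using btg by (auto simp: binary_tree_graphs_def)

lemma leaf_in_V: "i \<in> {1..n} \<Longrightarrow> i \<in> V"
  using leaves by blast

lemma leaf_degree: "i \<in> {1..n} \<Longrightarrow> degree E i = 1"
  using leaves by blast

sublocale rooted_tree V E l
proof
  show "is_tree V E" using btg by (simp add: binary_tree_graphs_def)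
  show "l \<in> V" using leaf_in_V root_leaf .
qed

abbreviation C :: "nat \<Rightarrow> nat set" where "C v \<equiv> cluster n l E v"

lemma C_iff: "i \<in> C v \<longleftrightarrow> i \<in> {1..n} \<and> le i v"
  unfolding cluster_def le_def P_def using leaf_in_V by auto

lemma C_subset: "C v \<subseteq> {1..n}"
  by (auto simp: cluster_def)

lemma leaf_no_child: "i \<in> {1..n} \<Longrightarrow> i \<noteq> l \<Longrightarrow> \<not> child i c"
proof -
  assume i: "i \<in> {1..n}" "i \<noteq> l"
  then obtain u where "child u i" using parent_exists leaf_in_V by blast
  then have "card {c. child i c} = 0" using degree_nonroot[of u i] leaf_degree[OF i(1)] by simp
  then show ?thesis using finite_children[of i] by simp
qed

lemma le_leaf: "i \<in> {1..n} \<Longrightarrow> i \<noteq> l \<Longrightarrow> le x i \<longleftrightarrow> x = i"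
  using below_child leaf_no_child le_refl leaf_in_V by blast

lemma C_leaf: "i \<in> {1..n} \<Longrightarrow> i \<noteq> l \<Longrightarrow> C i = {i}"
  using C_iff le_leaf by blast

lemma C_root: "C l = {1..n}"
  using C_iff le_root leaf_in_V by blast

lemma inner_children:
  assumes "v \<in> V" "v \<notin> {1..n}"
  obtains c d where "c \<noteq> d" "\<And>x. child v x \<longleftrightarrow> x = c \<or> x = d"
proof -
  have "v \<noteq> l" using assms root_leaf by auto
  then obtain u where "child u v" using parent_exists assms by blast
  then have "card {c. child v c} = 2" using degree_nonroot[of u v] inner_degree[OF assms] by simp
  then obtain c d where "{c. child v c} = {c, d}" "c \<noteq> d" unfolding card_2_iff by blast
  then show ?thesis using that[of c d] by (simp add: set_eq_iff)
qed

lemma root_child: obtains t where "\<And>x. child l x \<longleftrightarrow> x = t"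
proof -
  have "card {c. child l c} = 1" using degree_root leaf_degree[OF root_leaf] by simp
  then obtain t where "{c. child l c} = {t}" by (rule card_1_singletonE)
  then show ?thesis using that[of t] by (simp add: set_eq_iff)
qed

lemma finite_below: "finite {x. le x v}"
  using finite_V by (rule rev_finite_subset) (auto simp: le_def)

lemma below_child_card: "child v c \<Longrightarrow> card {x. le x c} < card {x. le x v}"
proof (rule psubset_card_mono[OF finite_below])
  assume c: "child v c"
  have "\<not> le v c" using c child_le child_neq le_antisym by blast
  moreover have "le v v" using c le_refl by (simp add: child_def)
  ultimately show "{x. le x c} \<subset> {x. le x v}" using child_le[OF c] le_trans by blast
qed

lemma hier_below:
  assumes "v \<in> V" "v \<noteq> l"
  shows "hier (C v) (C ` {u. le u v})"
  using assms
proof (induction "card {x. le x v}" arbitrary: v rule: less_induct)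
  case less
  show ?case
  proof (cases "v \<in> {1..n}")
    case True
    then have "{u. le u v} = {v}" "C v = {v}" using le_leaf C_leaf less.prems by auto
    then show ?thesis using hier.single[of v] by simp
  next
    case False
    obtain c d where cd: "c \<noteq> d" "\<And>x. child v x \<longleftrightarrow> x = c \<or> x = d"
      by (rule inner_children[OF less.prems(1) False]) blast
    then have ch: "child v c" "child v d" by simp_all
    have below: "{u. le u v} = insert v ({u. le u c} \<union> {u. le u d})"
    proof (intro equalityI subsetI)
      fix u assume "u \<in> {u. le u v}"
      then show "u \<in> insert v ({u. le u c} \<union> {u. le u d})" using below_child[of u v] cd(2) by auto
    next
      fix u assume "u \<in> insert v ({u. le u c} \<union> {u. le u d})"
      then show "u \<in> {u. le u v}"
        using le_refl[OF less.prems(1)] child_le[OF ch(1)] child_le[OF ch(2)] le_trans by blast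
    qed
    have Cv: "C v = C c \<union> C d"
    proof (rule set_eqI)
      fix i
      have "i \<in> {1..n} \<Longrightarrow> i \<noteq> v" using False by auto
      moreover have "le i v \<longleftrightarrow> i = v \<or> le i c \<or> le i d" using below by blast
      ultimately show "i \<in> C v \<longleftrightarrow> i \<in> C c \<union> C d" unfolding Un_iff C_iff by blast
    qed
    have "C c \<inter> C d = {}"
      using children_incomparable[OF ch] cd(1) unfolding disjoint_iff C_iff by blast
    moreover have "c \<in> V" "c \<noteq> l" "d \<in> V" "d \<noteq> l"
      using ch child_not_root by (auto simp: child_def)
    ultimately have "hier (C c \<union> C d) (insert (C c \<union> C d) (C ` {u. le u c} \<union> C ` {u. le u d}))"
      using below_child_card[OF ch(1)] below_child_card[OF ch(2)] less.hyps
      by (intro hier.join) auto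
    then show ?thesis unfolding below Cv image_insert image_Un .
  qed
qed

lemma hier_clusters: "hier ({1..n} - {l}) (clusters n l (V, E))"
proof -
  obtain t where t: "\<And>x. child l x \<longleftrightarrow> x = t" by (rule root_child) blast
  then have tc: "child l t" by simp
  have not_l: "\<not> le l t" using tc child_le child_neq le_antisym by blast
  have "V - {l} = {u. le u t}"
  proof (intro equalityI subsetI)
    fix u assume "u \<in> V - {l}"
    then show "u \<in> {u. le u t}" using below_child[of u l] le_root[of u] t by auto
  next
    fix u assume "u \<in> {u. le u t}"
    then show "u \<in> V - {l}" using le_in_V not_l by blast
  qed
  moreover have "C t = {1..n} - {l}"
  proof (rule set_eqI)
    fix i
    have "le i t" if "i \<in> {1..n}" "i \<noteq> l"
      using below_child[of i l] le_root[of i] leaf_in_V[of i] that t by auto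
    then show "i \<in> C t \<longleftrightarrow> i \<in> {1..n} - {l}" using not_l C_iff by blast
  qed
  moreover have "t \<in> V" "t \<noteq> l" using tc child_not_root by (auto simp: child_def)
  ultimately show ?thesis using hier_below[of t] by (simp add: clusters_def)
qed

lemma C_nonempty: "v \<in> V \<Longrightarrow> C v \<noteq> {}"
proof (cases "v = l")
  case True
  then show ?thesis using C_root n2 by simp
next
  case False
  assume "v \<in> V"
  then show ?thesis using hier_nonempty[OF hier_below[OF _ False]] by blast
qed

lemma C_mono: "le u v \<Longrightarrow> C u \<subseteq> C v"
  using C_iff le_trans by blast

text \<open>An inner vertex has a second child, whose cluster is nonempty and disjoint from that of the first;
  the root has only one child, whose cluster lacks the leaf \<open>l\<close>. This strictness makes clusters a faithful image of the ancestor order.\<close>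

lemma C_child: "child v c \<Longrightarrow> C c \<subset> C v"
proof -
  assume c: "child v c"
  then have V: "v \<in> V" by (simp add: child_def)
  have "C c \<noteq> C v"
  proof (cases "v = l")
    case True
    have "\<not> le l c" using c True child_le child_neq le_antisym by blast
    then have "l \<notin> C c" "l \<in> C l" using C_iff C_root root_leaf by auto
    then show ?thesis using True by auto
  next
    case False
    then have "v \<notin> {1..n}" using leaf_no_child c by blast
    obtain a b where "a \<noteq> b" "\<And>x. child v x \<longleftrightarrow> x = a \<or> x = b"
      by (rule inner_children[OF V \<open>v \<notin> {1..n}\<close>]) blast
    then obtain d where d: "child v d" "d \<noteq> c" by metis
    then have "d \<in> V" by (simp add: child_def)
    then obtain i where "i \<in> C d" using C_nonempty by blast
    moreover then have "i \<notin> C c" using children_incomparable[OF c d(1)] d(2) C_iff by blast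
    ultimately show ?thesis using C_mono[OF child_le[OF d(1)]] by blast
  qed
  then show ?thesis using C_mono[OF child_le[OF c]] by blast
qed

lemma C_subset_iff: "u \<in> V \<Longrightarrow> v \<in> V \<Longrightarrow> C u \<subseteq> C v \<longleftrightarrow> le u v"
proof
  assume V: "u \<in> V" "v \<in> V" and sub: "C u \<subseteq> C v"
  obtain i where "i \<in> C u" using C_nonempty V by blast
  then have "le i u" "le i v" using sub C_iff by blast+
  then have "le u v \<or> le v u" by (rule le_comparable)
  moreover have "v = u" if vu: "le v u"
  proof (rule ccontr)
    assume "v \<noteq> u"
    then obtain c where "child u c" "le v c" using below_child vu by blast
    then have "C v \<subset> C u" using C_mono C_child by blast
    then show False using sub by blast
  qed
  ultimately show "le u v" using le_refl V by blast
qed (rule C_mono)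

lemma inj_on_C: "inj_on C V"
  using C_subset_iff le_antisym by (intro inj_onI) blast

lemma C_image: "C ` V = insert {1..n} (clusters n l (V, E))"
proof -
  have "V = insert l (V - {l})" using root_in_V by blast
  then have "C ` V = insert (C l) (C ` (V - {l}))" by (metis image_insert)
  then show ?thesis by (simp add: C_root clusters_def)
qed

text \<open>Edges are expressed by the order alone, so they are preserved by order isomorphisms.\<close>

lemma child_iff_cover:
  "child v c \<longleftrightarrow> le c v \<and> c \<noteq> v \<and> (\<forall>y\<in>V. le c y \<longrightarrow> le y v \<longrightarrow> y = c \<or> y = v)"
proof (intro iffI conjI ballI impI)
  assume r: "le c v \<and> c \<noteq> v \<and> (\<forall>y\<in>V. le c y \<longrightarrow> le y v \<longrightarrow> y = c \<or> y = v)"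
  then obtain d where d: "child v d" "le c d" using below_child by blast
  then have "d = c \<or> d = v" using r child_le le_in_V by blast
  then show "child v c" using d child_neq by blast
qed (use child_le child_neq child_rigid in blast)+

lemma edge_iff_child: "{x, y} \<in> E \<longleftrightarrow> child x y \<or> child y x"
  using edge_child[of x y] child_edge[of x y] child_edge[of y x] by (auto simp: insert_commute)

end

lemma clusters_iso:
  assumes "leaf_rooted V E n l" "leaf_rooted V' E' n l" "graph_iso {1..n} (V, E) (V', E')"
  shows "clusters n l (V, E) = clusters n l (V', E')"
proof -
  interpret G: leaf_rooted V E n l by fact
  interpret G': leaf_rooted V' E' n l by fact
  obtain f where f: "bij_betw f V V'" "E' = (\<lambda>e. f ` e) ` E" "\<forall>i\<in>{1..n}. f i = i"
    using assms(3) by (auto simp: graph_iso_def)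
  have fl: "f l = l" using f G.root_leaf by blast
  have inj: "inj_on f V" and im: "f ` V = V'" using f by (auto simp: bij_betw_def)
  have P: "G'.P (f x) = map f (G.P x)" if "x \<in> V" for x
  proof (rule G'.P_eqI)
    show "f x \<in> V'" using im that by blast
    have "inj_on f (set (G.P x))" using inj G.P_in_V[OF that] by (rule inj_on_subset)
    then show "is_path E' l (map f (G.P x)) (f x)"
      using is_path_map[OF G.P_path[OF that], of f] fl f(2) by simp
  qed
  have C: "G'.C (f v) = G.C v" if "v \<in> V" for v
  proof (rule set_eqI)
    fix i
    show "i \<in> G'.C (f v) \<longleftrightarrow> i \<in> G.C v"
    proof (cases "i \<in> {1..n}")
      case True
      then have "G'.P i = map f (G.P i)" using P[of i] f(3) G.leaf_in_V by auto
      moreover have "f v \<in> f ` set (G.P i) \<longleftrightarrow> v \<in> set (G.P i)"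
        using inj_on_image_mem_iff[OF inj that G.P_in_V[OF G.leaf_in_V[OF True]]] .
      ultimately show ?thesis using True by (simp add: cluster_def G.P_def G'.P_def)
    qed (auto simp: cluster_def)
  qed
  have "f ` (V - {l}) = V' - {l}"
    using inj_on_image_set_diff[OF inj, of V "{l}"] im fl G.root_in_V by simp
  then have "clusters n l (V', E') = G'.C ` f ` (V - {l})" by (simp add: clusters_def)
  also have "\<dots> = G.C ` (V - {l})" unfolding image_image using C by (intro image_cong) auto
  finally show ?thesis by (simp add: clusters_def)
qed

text \<open>A tree is the Hasse diagram of its clusters, together with the set of all leaves.\<close>

lemma clusters_eq_imp_iso:
  assumes "leaf_rooted V E n l" "leaf_rooted V' E' n l"
    and eq: "clusters n l (V, E) = clusters n l (V', E')"
  shows "graph_iso {1..n} (V, E) (V', E')"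
proof -
  interpret G: leaf_rooted V E n l by fact
  interpret G': leaf_rooted V' E' n l by fact
  define f where "f = inv_into V' G'.C \<circ> G.C"
  have im: "G.C ` V = G'.C ` V'" unfolding G.C_image G'.C_image eq ..
  have bij: "bij_betw f V V'"
    unfolding f_def
  proof (rule bij_betw_trans)
    show "bij_betw G.C V (G'.C ` V')" using G.inj_on_C im by (simp add: bij_betw_def)
    show "bij_betw (inv_into V' G'.C) (G'.C ` V') V'"
      using G'.inj_on_C by (intro bij_betw_inv_into) (simp add: bij_betw_def)
  qed
  have fV: "f v \<in> V'" if "v \<in> V" for v using bij that by (auto simp: bij_betw_def)
  have Cf: "G'.C (f v) = G.C v" if "v \<in> V" for v
    using that im unfolding f_def by (metis comp_apply f_inv_into_f imageI)
  have le: "G'.le (f u) (f v) \<longleftrightarrow> G.le u v" if "u \<in> V" "v \<in> V" for u v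
    using that G.C_subset_iff[OF that] G'.C_subset_iff[OF fV[OF that(1)] fV[OF that(2)]] Cf by simp
  have inj: "inj_on f V" and surj: "f ` V = V'" using bij by (auto simp: bij_betw_def)
  have child: "G'.child (f v) (f c) \<longleftrightarrow> G.child v c" if V: "v \<in> V" "c \<in> V" for v c
  proof -
    have "(\<forall>y\<in>V'. G'.le (f c) y \<longrightarrow> G'.le y (f v) \<longrightarrow> y = f c \<or> y = f v) \<longleftrightarrow>
        (\<forall>y\<in>V. G'.le (f c) (f y) \<longrightarrow> G'.le (f y) (f v) \<longrightarrow> f y = f c \<or> f y = f v)"
      unfolding surj[symmetric] by blast
    also have "\<dots> \<longleftrightarrow> (\<forall>y\<in>V. G.le c y \<longrightarrow> G.le y v \<longrightarrow> y = c \<or> y = v)"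
      using le V inj_on_eq_iff[OF inj] by auto
    finally show ?thesis
      unfolding G.child_iff_cover G'.child_iff_cover
      using le[OF V(2,1)] inj_on_eq_iff[OF inj V(2,1)] by blast
  qed
  have edge: "{f x, f y} \<in> E' \<longleftrightarrow> {x, y} \<in> E" if "x \<in> V" "y \<in> V" for x y
    unfolding G.edge_iff_child G'.edge_iff_child using child that by blast
  have "E' = (\<lambda>e. f ` e) ` E"
  proof (intro equalityI subsetI)
    fix e assume e: "e \<in> E'"
    obtain a b where "e = {a, b}" "a \<in> V'" "b \<in> V'" using G'.edge_cases[OF e] by blast
    then obtain x y where xy: "x \<in> V" "y \<in> V" "e = {f x, f y}" using surj by blast
    then have "{x, y} \<in> E" using edge e by blast
    then show "e \<in> (\<lambda>e. f ` e) ` E" using xy by (intro image_eqI[of _ _ "{x, y}"]) auto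
  next
    fix e assume "e \<in> (\<lambda>e. f ` e) ` E"
    then obtain d where d: "d \<in> E" "e = f ` d" by blast
    obtain x y where "d = {x, y}" "x \<in> V" "y \<in> V" using G.edge_cases[OF d(1)] by blast
    then show "e \<in> E'" using edge d by simp
  qed
  moreover have "f i = i" if i: "i \<in> {1..n}" for i
  proof -
    have "G.C i = G'.C i"
      using i by (cases "i = l") (simp_all add: G.C_root G'.C_root G.C_leaf G'.C_leaf)
    then have "G'.C (f i) = G'.C i" using Cf G.leaf_in_V[OF i] by simp
    then show ?thesis
      using inj_on_eq_iff[OF G'.inj_on_C fV[OF G.leaf_in_V[OF i]] G'.leaf_in_V[OF i]] by simp
  qed
  ultimately show ?thesis using bij by (auto simp: graph_iso_def)
qed

section \<open>Every binary hierarchy comes from a tree\<close>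

text \<open>An inner vertex of a path has two different neighbours, but \<open>w\<close> has only \<open>p\<close>.\<close>

lemma is_path_avoids_pendant:
  assumes "is_path (insert {w, p} E) u q v" "\<And>e. e \<in> E \<Longrightarrow> w \<notin> e" "u \<noteq> w" "v \<noteq> w" "w \<noteq> p"
  shows "w \<notin> set q" "is_path E u q v"
proof -
  show w: "w \<notin> set q"
  proof
    assume "w \<in> set q"
    then obtain a b where q: "q = a @ w # b" by (metis split_list)
    then have "a \<noteq> []" "b \<noteq> []" using assms(1,3,4) by (auto simp: is_path_def)
    moreover have "x = p" if "{x, w} \<in> insert {w, p} E" for x
      using that assms(2,5) by (auto simp: doubleton_eq_iff)
    ultimately have "last a = p" "hd b = p"
      using assms(1) unfolding q is_path_def
      by (auto simp: successively_append_iff successively_Cons insert_commute)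
    then have "p \<in> set a" "p \<in> set b" 
      using hd_in_set[of b] last_in_set[of a] \<open>a \<noteq> []\<close> \<open>b \<noteq> []\<close> by simp_all
    then show False using assms(1) unfolding q is_path_def by auto
  qed
  show "is_path E u q v"
    using assms(1) by (rule is_path_mono) (use w in \<open>auto simp: doubleton_eq_iff\<close>)
qed

lemma is_tree_insert_pendant:
  assumes "is_tree V E" "w \<notin> V" "p \<in> V"
  shows "is_tree (insert w V) (insert {w, p} E)"
proof -
  interpret tree V E by unfold_locales fact
  let ?E = "insert {w, p} E"
  have wE: "w \<notin> e" if "e \<in> E" for e using edge_cases[OF that] assms(2) by auto
  have wp: "w \<noteq> p" using assms by auto
  note avoid = is_path_avoids_pendant[OF _ wE _ _ wp]
  have old: "is_path ?E u q v" if "is_path E u q v" for u q v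
    using that by (rule is_path_mono) auto
  have uniq: "\<exists>!q. is_path ?E u q v" if "u \<in> V" "v \<in> V" for u v
  proof -
    have "is_path ?E u q v \<longleftrightarrow> is_path E u q v" for q
    proof
      assume "is_path ?E u q v"
      then show "is_path E u q v" by (rule avoid(2)) (use that assms(2) in auto)
    qed (rule old)
    then show ?thesis using assms(1) that by (simp add: is_tree_def)
  qed
  have from_w: "\<exists>!q. is_path ?E w q v" if v: "v \<in> V" for v
  proof -
    have "is_path ?E w q v \<longleftrightarrow> (\<exists>q'. q = w # q' \<and> is_path E p q' v)" for q
    proof
      assume q: "is_path ?E w q v"
      then obtain q' where q': "q = w # q'" by (cases q) (auto simp: is_path_def)
      have "q' \<noteq> []" using q v assms(2) unfolding q' by (auto simp: is_path_def)
      then have "{w, hd q'} \<in> ?E" "w \<noteq> hd q'" and *: "is_path ?E (hd q') q' v"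
        using q unfolding q' by (auto simp: is_path_def successively_Cons)
      then have "hd q' = p" using wE[of "{w, hd q'}"] by (auto simp: doubleton_eq_iff)
      then show "\<exists>q'. q = w # q' \<and> is_path E p q' v"
        using q' avoid(2)[where u = p and q = q' and v = v] * v assms(2) wp by blast
    next
      assume "\<exists>q'. q = w # q' \<and> is_path E p q' v"
      then obtain q' where q': "q = w # q'" "is_path E p q' v" by auto
      then have "w \<notin> set q'" using path_in_V[OF q'(2) assms(3)] assms(2) by auto
      then show "is_path ?E w q v"
        using old[OF q'(2)] q'(1) by (auto simp: is_path_def successively_Cons)
    qed
    moreover have "\<exists>!q'. is_path E p q' v" using assms(1,3) v by (simp add: is_tree_def)
    ultimately show ?thesis by auto
  qed
  have to_w: "\<exists>!q. is_path ?E v q w" if v: "v \<in> V" for v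
  proof -
    have "is_path ?E v q w \<longleftrightarrow> is_path ?E w (rev q) v" for q
      using is_path_rev[of ?E v q w] is_path_rev[of ?E w "rev q" v] by auto
    then show ?thesis using from_w[OF v] by (metis rev_rev_ident)
  qed
  have ww: "\<exists>!q. is_path ?E w q w"
  proof (rule ex1I[of _ "[w]"])
    show "is_path ?E w [w] w" by simp
    show "q = [w]" if "is_path ?E w q w" for q using that by (rule is_path_same)
  qed
  have "simple_graph (insert w V) ?E"
    using assms wp unfolding is_tree_def simple_graph_def by auto
  then show ?thesis
    unfolding is_tree_def using uniq from_w to_w ww by auto
qed

text \<open>The rank excludes cycles. A nonroot vertex of minimal rank is nobody's parent, so it is pendant and can be
  removed.\<close>

lemma is_tree_parent:
  fixes rank :: "nat \<Rightarrow> nat"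
  assumes "finite V" "r \<in> V" "\<And>v. v \<in> V - {r} \<Longrightarrow> par v \<in> V \<and> rank v < rank (par v)"
  shows "is_tree V ((\<lambda>v. {v, par v}) ` (V - {r}))"
  using assms
proof (induction "card V" arbitrary: V)
  case 0
  then show ?case by simp
next
  case (Suc k)
  show ?case
  proof (cases "V = {r}")
    case True
    have "is_path {} r p r \<longleftrightarrow> p = [r]" for p
      using is_path_same[of "{}" r p] by auto
    then show ?thesis using True by (simp add: is_tree_def simple_graph_def)
  next
    case False
    then have ne: "V - {r} \<noteq> {}" "finite (V - {r})" using Suc.prems by auto
    define w where "w = arg_min_on rank (V - {r})"
    have w: "w \<in> V - {r}" using ne unfolding w_def by (intro arg_min_if_finite)
    have min: "\<not> rank v < rank w" if "v \<in> V - {r}" for v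
      using arg_min_if_finite(2)[OF ne(2,1)] that unfolding w_def by blast
    have "is_tree (V - {w}) ((\<lambda>v. {v, par v}) ` (V - {w} - {r}))"
    proof (rule Suc.hyps(1))
      show "k = card (V - {w})" using Suc.hyps(2) w Suc.prems(1) by simp
      show "par v \<in> V - {w} \<and> rank v < rank (par v)" if "v \<in> V - {w} - {r}" for v
        using Suc.prems(3)[of v] min[of v] that by auto
    qed (use Suc.prems w in auto)
    then have "is_tree (insert w (V - {w}))
        (insert {w, par w} ((\<lambda>v. {v, par v}) ` (V - {w} - {r})))"
      by (rule is_tree_insert_pendant) (use Suc.prems(3)[OF w] in auto)
    moreover have "insert w (V - {w}) = V" and *: "insert w (V - {w} - {r}) = V - {r}"
      using w by auto
    moreover have "(\<lambda>v. {v, par v}) ` (V - {r}) =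
        insert {w, par w} ((\<lambda>v. {v, par v}) ` (V - {w} - {r}))"
      unfolding *[symmetric] by (rule image_insert)
    ultimately show ?thesis by simp
  qed
qed

text \<open>The tree of a hierarchy is its Hasse diagram after adding the full leaf set as a new top, which
  becomes the root \<open>l\<close>.\<close>

locale hasse =
  fixes n l :: nat and H :: "nat set set"
  assumes hier: "hier ({1..n} - {l}) H" and l: "l \<in> {1..n}" and n2: "2 \<le> n"
begin

definition "Top = {1..n}"

definition "N = insert Top H"

text \<open>Vertices have to be natural numbers and the leaf \<open>i\<close> has to be the number \<open>i\<close>. The other sets get
  numbers above \<open>n\<close>.\<close>

definition name :: "nat set \<Rightarrow> nat" where
  "name A = (if A = Top then l else if \<exists>i. A = {i} then the_elem A else n + 1 + set_encode A)"

text \<open>The least proper superset; it exists because the supersets of a nonempty set in a laminar family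
  form a chain.\<close>

definition parent :: "nat set \<Rightarrow> nat set" where
  "parent A = (SOME B. B \<in> N \<and> A \<subset> B \<and> (\<forall>D\<in>N. A \<subset> D \<longrightarrow> B \<subseteq> D))"

definition par :: "nat \<Rightarrow> nat" where
  "par v = name (parent (inv_into N name v))"

definition "W = name ` N"

definition "F = (\<lambda>v. {v, par v}) ` (W - {l})"

lemma member_H: "A \<in> H \<Longrightarrow> A \<noteq> {} \<and> A \<subset> Top \<and> l \<notin> A"
  using hier_subset[OF hier] hier_member_nonempty[OF hier] l unfolding Top_def by blast

lemma top_not_single: "Top \<noteq> {i}"
proof
  assume "Top = {i}"
  then have "card Top = 1" by simp
  then show False using n2 by (simp add: Top_def)
qed

lemma top_not_H: "Top \<notin> H"
  using member_H by blast

lemma N_subset: "A \<in> N \<Longrightarrow> A \<subseteq> Top \<and> A \<noteq> {}"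
  using member_H l unfolding N_def Top_def by blast

lemma finite_N: "finite N"
  using hier_finite_family[OF hier] by (simp add: N_def)

lemma N_finite: "A \<in> N \<Longrightarrow> finite A"
  using N_subset finite_subset[of A Top] unfolding Top_def by blast

lemma N_laminar: "A \<in> N \<Longrightarrow> B \<in> N \<Longrightarrow> A \<subseteq> B \<or> B \<subseteq> A \<or> A \<inter> B = {}"
  using hier_laminar[OF hier] member_H unfolding N_def by blast

lemma name_top: "name Top = l"
  by (simp add: name_def)

lemma name_leaf: "name {i} = i"
  using top_not_single by (auto simp: name_def)

lemma name_other: "A \<noteq> Top \<Longrightarrow> (\<And>i. A \<noteq> {i}) \<Longrightarrow> name A = n + 1 + set_encode A"
  by (simp add: name_def)

lemma inj_name: "inj_on name N"
proof (rule inj_onI)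
  fix A B assume AB: "A \<in> N" "B \<in> N" "name A = name B"
  have cases: "A = Top \<and> name A = l \<or> (\<exists>i. A = {i} \<and> i \<noteq> l \<and> i \<le> n \<and> name A = i) \<or>
      A \<noteq> Top \<and> (\<forall>i. A \<noteq> {i}) \<and> name A = n + 1 + set_encode A" if "A \<in> N" for A
  proof (cases "A = Top")
    case False
    then have "A \<in> H" using that by (simp add: N_def)
    then show ?thesis
      using member_H[of A] name_leaf name_other[of A]
      by (cases "\<exists>i. A = {i}") (auto simp: Top_def)
  qed (simp add: name_top)
  have "l \<le> n" using l by simp
  then show "A = B"
    using cases[OF AB(1)] cases[OF AB(2)] AB(3)
      set_encode_eq[OF N_finite[OF AB(1)] N_finite[OF AB(2)]] by (elim disjE exE conjE) simp_all
qed

lemma parent: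
  assumes "A \<in> H"
  shows "parent A \<in> N" "A \<subset> parent A" "D \<in> N \<Longrightarrow> A \<subset> D \<Longrightarrow> parent A \<subseteq> D"
proof -
  let ?S = "{B \<in> N. A \<subset> B}"
  have fin: "finite ?S" and ne: "?S \<noteq> {}"
    using finite_N member_H[OF assms] by (auto simp: N_def)
  define B where "B = arg_min_on card ?S"
  have B: "B \<in> ?S" using arg_min_if_finite(1)[OF fin ne] by (simp add: B_def)
  have "B \<subseteq> D" if D: "D \<in> N" "A \<subset> D" for D
  proof (rule ccontr)
    assume not: "\<not> B \<subseteq> D"
    have "A \<noteq> {}" using member_H[OF assms] by blast
    then have "B \<inter> D \<noteq> {}" using B D by blast
    then have "D \<subset> B" using N_laminar[of B D] B D not by blast
    then have "card D < card B" using N_finite[of B] B by (simp add: psubset_card_mono)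
    then show False using arg_min_if_finite(2)[OF fin ne] D by (auto simp: B_def)
  qed
  then have "\<exists>B. B \<in> N \<and> A \<subset> B \<and> (\<forall>D\<in>N. A \<subset> D \<longrightarrow> B \<subseteq> D)" using B by blast
  from someI_ex[OF this]
  show "parent A \<in> N" "A \<subset> parent A" "D \<in> N \<Longrightarrow> A \<subset> D \<Longrightarrow> parent A \<subseteq> D"
    unfolding parent_def by blast+
qed

lemma l_in_W: "l \<in> W"
proof -
  have "name Top \<in> name ` N" by (rule imageI) (simp add: N_def)
  then show ?thesis by (simp add: W_def name_top)
qed

lemma W_nonroot: "W - {l} = name ` H"
proof -
  have "name ` (N - {Top}) = name ` N - name ` {Top}"
    by (rule inj_on_image_set_diff[OF inj_name]) (auto simp: N_def)
  moreover have "N - {Top} = H" using top_not_H by (simp add: N_def)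
  ultimately show ?thesis by (simp add: W_def name_top)
qed

lemma par_name: "A \<in> H \<Longrightarrow> par (name A) = name (parent A)"
  using inv_into_f_f[OF inj_name, of A] by (simp add: par_def N_def)

lemma F_eq: "F = (\<lambda>A. {name A, name (parent A)}) ` H"
  unfolding F_def W_nonroot image_image using par_name by (intro image_cong) auto

lemma is_tree: "is_tree W F"
  unfolding F_def
proof (rule is_tree_parent[where rank = "\<lambda>v. card (inv_into N name v)"])
  show "finite W" using finite_N by (simp add: W_def)
  show "l \<in> W" by (rule l_in_W)
  fix v assume "v \<in> W - {l}"
  then obtain A where A: "A \<in> H" "v = name A" unfolding W_nonroot by blast
  have "card A < card (parent A)"
    using parent[OF A(1)] N_finite by (simp add: psubset_card_mono)
  moreover have "inv_into N name v = A" "inv_into N name (par v) = parent A"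
    unfolding A(2) par_name[OF A(1)]
    using A(1) parent(1)[OF A(1)] inv_into_f_f[OF inj_name] by (auto simp: N_def)
  ultimately show "par v \<in> W \<and> card (inv_into N name v) < card (inv_into N name (par v))"
    using parent(1)[OF A(1)] by (auto simp: A par_name W_def)
qed

sublocale rooted_tree W F l
proof
  show "is_tree W F" by (rule is_tree)
  show "l \<in> W" by (rule l_in_W)
qed

lemma name_in_W: "A \<in> N \<Longrightarrow> name A \<in> W"
  by (simp add: W_def)

text \<open>The path from the root to a set passes through its supersets in decreasing order. Hence the
  ancestor order of the tree is inclusion, and the clusters of the tree are the sets of \<open>H\<close>.\<close>

lemma P_name:
  assumes "A \<in> N"
  shows "set (P (name A)) = name ` {D \<in> N. A \<subseteq> D} \<and>
    (A \<in> H \<longrightarrow> P (name A) = P (name (parent A)) @ [name A])"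
  using assms
proof (induction "n - card A" arbitrary: A rule: less_induct)
  case less
  show ?case
  proof (cases "A = Top")
    case True
    then have "{D \<in> N. A \<subseteq> D} = {Top}" using N_subset less.prems by auto
    then show ?thesis using True name_top top_not_H by simp
  next
    case False
    then have A: "A \<in> H" using less.prems by (simp add: N_def)
    note p = parent[OF A]
    have "card A < card (parent A)" using p(1,2) N_finite by (simp add: psubset_card_mono)
    moreover have "card (parent A) \<le> n"
      using N_subset[OF p(1)] card_mono[of Top "parent A"] by (simp add: Top_def)
    ultimately have "n - card (parent A) < n - card A" by simp
    then have IH: "set (P (name (parent A))) = name ` {D \<in> N. parent A \<subseteq> D}"
      using less.hyps p(1) by blast
    have "name A \<notin> set (P (name (parent A)))"
    proof
      assume "name A \<in> set (P (name (parent A)))"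
      then obtain D where "D \<in> N" "parent A \<subseteq> D" "name A = name D" unfolding IH by blast
      then have "D = A" using inj_on_eq_iff[OF inj_name] less.prems by metis
      then show False using p(2) \<open>parent A \<subseteq> D\<close> by blast
    qed
    moreover have "{name (parent A), name A} \<in> F"
      using A by (auto simp: F_eq insert_commute)
    ultimately have P: "P (name A) = P (name (parent A)) @ [name A]"
      by (intro P_eqI[OF name_in_W[OF less.prems]]
          is_path_snoc[OF P_path[OF name_in_W[OF p(1)]]])
    have "{D \<in> N. A \<subseteq> D} = insert A {D \<in> N. parent A \<subseteq> D}"
      using less.prems p by blast
    then show ?thesis using P IH by auto
  qed
qed

lemma le_name: "A \<in> N \<Longrightarrow> B \<in> N \<Longrightarrow> le (name A) (name B) \<longleftrightarrow> A \<subseteq> B"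
proof -
  assume AB: "A \<in> N" "B \<in> N"
  then have "le (name A) (name B) \<longleftrightarrow> name B \<in> name ` {D \<in> N. A \<subseteq> D}"
    using P_name[OF AB(1)] name_in_W by (auto simp: le_def)
  also have "\<dots> \<longleftrightarrow> B \<in> {D \<in> N. A \<subseteq> D}"
    using AB by (intro inj_on_image_mem_iff[OF inj_name]) auto
  finally show ?thesis using AB by simp
qed

lemma child_name: "A \<in> H \<Longrightarrow> child (name (parent A)) (name A)"
  using P_name[of A] parent(1)[of A] name_in_W by (auto simp: child_def N_def)

lemma child_name_iff:
  assumes "B \<in> N" shows "child (name B) x \<longleftrightarrow> (\<exists>A\<in>H. x = name A \<and> parent A = B)"
proof
  assume c: "child (name B) x"
  then have "x \<in> W - {l}" using child_not_root by (auto simp: child_def)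
  then obtain A where A: "A \<in> H" "x = name A" unfolding W_nonroot by blast
  then have "name (parent A) = name B" using parent_unique c child_name by blast
  then have "parent A = B" using inj_on_eq_iff[OF inj_name parent(1)[OF A(1)] assms] by blast
  then show "\<exists>A\<in>H. x = name A \<and> parent A = B" using A by blast
qed (use child_name in blast)

lemma card_children:
  "B \<in> N \<Longrightarrow> card {x. child (name B) x} = card {A \<in> H. parent A = B}"
proof -
  assume "B \<in> N"
  then have "{x. child (name B) x} = name ` {A \<in> H. parent A = B}"
    using child_name_iff by blast
  moreover have "inj_on name {A \<in> H. parent A = B}"
    using inj_name by (rule inj_on_subset) (auto simp: N_def)
  ultimately show ?thesis using card_image by metis
qed

lemma degree_top: "degree F l = 1"
proof -
  let ?X = "{1..n} - {l}"
  have X: "?X \<in> H" using hier_top[OF hier] .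
  have "{A \<in> H. parent A = Top} = {?X}"
  proof (intro equalityI subsetI)
    fix A assume "A \<in> {A \<in> H. parent A = Top}"
    then have A: "A \<in> H" "parent A = Top" by auto
    show "A \<in> {?X}"
    proof (rule ccontr)
      assume "A \<notin> {?X}"
      then have "A \<subset> ?X" using hier_subset[OF hier A(1)] by blast
      then have "parent A \<subseteq> ?X" using parent(3)[OF A(1)] X by (simp add: N_def)
      then show False using A l Top_def by blast
    qed
  next
    fix A assume "A \<in> {?X}"
    then have "A = ?X" by simp
    moreover have "parent ?X = Top"
      using parent(1,2)[OF X] hier_subset[OF hier] unfolding N_def by blast
    ultimately show "A \<in> {A \<in> H. parent A = Top}" using X by simp
  qed
  then show ?thesis
    using degree_root card_children[of "Top"] name_top by (simp add: N_def)
qed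

lemma degree_leaf: "{i} \<in> H \<Longrightarrow> degree F i = 1"
proof -
  assume i: "{i} \<in> H"
  have "parent A \<noteq> {i}" if "A \<in> H" for A
    using parent(2)[OF that] member_H[OF that] by auto
  then have none: "{A \<in> H. parent A = {i}} = {}" by blast
  have "card {x. child (name {i}) x} = 0"
    using card_children[of "{i}"] i unfolding none by (simp add: N_def)
  then show ?thesis using degree_nonroot[OF child_name[OF i]] name_leaf by simp
qed

lemma degree_inner:
  assumes "A \<in> H" "\<And>i. A \<noteq> {i}" shows "degree F (name A) = 3"
proof -
  obtain B D where BD: "B \<in> H" "D \<in> H" "A = B \<union> D" "B \<inter> D = {}"
    using hier_split[OF hier assms(1)] assms(2) by blast
  note ne = member_H[OF BD(1)] member_H[OF BD(2)]
  have one: "parent B = A" if BD: "B \<in> H" "D \<in> H" "A = B \<union> D" "B \<inter> D = {}" for B D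
  proof -
    have ne: "B \<noteq> {}" "D \<noteq> {}" using member_H BD by blast+
    have "A \<in> N" "D \<in> N" using assms BD by (auto simp: N_def)
    moreover have "B \<subset> A" using BD ne by blast
    ultimately have "parent B \<subseteq> A" using parent(3)[OF BD(1)] by blast
    moreover have "B \<subset> parent B" "parent B \<in> N" using parent[OF BD(1)] by blast+
    ultimately show ?thesis using N_laminar[of "parent B" D] \<open>D \<in> N\<close> BD ne by blast
  qed
  have "{C \<in> H. parent C = A} = {B, D}"
  proof (intro equalityI subsetI)
    fix C assume "C \<in> {C \<in> H. parent C = A}"
    then have C: "C \<in> H" "parent C = A" "C \<subset> A" using parent(2) by auto
    have "\<not> C \<subset> B" using parent(3)[OF C(1), of B] C BD(1,3) ne BD(4) by (auto simp: N_def)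
    moreover have "\<not> C \<subset> D" using parent(3)[OF C(1), of D] C BD(2,3) ne BD(4) by (auto simp: N_def)
    moreover have "C \<noteq> {}" using member_H[OF C(1)] by blast
    ultimately show "C \<in> {B, D}"
      using hier_laminar[OF hier C(1) BD(1)] hier_laminar[OF hier C(1) BD(2)] C(3) BD(3) by blast
  next
    fix C assume "C \<in> {B, D}"
    moreover have "parent B = A" using one[OF BD] .
    moreover have "parent D = A" using one[OF BD(2,1)] BD(3,4) by blast
    ultimately show "C \<in> {C \<in> H. parent C = A}" using BD by blast
  qed
  moreover have "B \<noteq> D" using BD ne by blast
  ultimately have "card {x. child (name A) x} = 2"
    using card_children[of A] assms by (simp add: N_def)
  then show ?thesis using degree_nonroot[OF child_name[OF assms(1)]] by simp
qed

lemma W_cases: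
  assumes "v \<in> W"
  obtains "v = l" | i where "{i} \<in> H" "v = i" "i \<in> {1..n}" | A where "A \<in> H" "\<And>i. A \<noteq> {i}" "v = name A" "v > n"
proof -
  obtain A where A: "A \<in> N" "v = name A" using assms by (auto simp: W_def)
  consider "A = Top" | i where "A = {i}" "A \<in> H" | "A \<in> H" "\<And>i. A \<noteq> {i}"
    using A(1) by (auto simp: N_def)
  then show ?thesis
  proof cases
    case 1 then show ?thesis using that A name_top by simp
  next
    case 2
    then have "i \<in> Top" using member_H by blast
    then show ?thesis using that 2 A name_leaf by (simp add: Top_def)
  next
    case 3
    then have "A \<noteq> Top" using top_not_H by blast
    then have "v > n" using name_other[of A] A 3 by simp
    then show ?thesis using that 3 A by blast
  qed
qed

lemma leaf_H: "i \<in> {1..n} \<Longrightarrow> i \<noteq> l \<Longrightarrow> {i} \<in> H"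
  using hier_singleton[OF hier] by blast

lemma binary: "(W, F) \<in> binary_tree_graphs n"
proof -
  have "{v \<in> W. degree F v = 1} = {1..n}"
  proof (intro equalityI subsetI)
    fix v assume "v \<in> {v \<in> W. degree F v = 1}"
    then have "v \<in> W" "degree F v = 1" by auto
    then show "v \<in> {1..n}"
      by (cases rule: W_cases) (use l degree_inner in auto)
  next
    fix i assume i: "i \<in> {1..n}"
    show "i \<in> {v \<in> W. degree F v = 1}"
    proof (cases "i = l")
      case True
      then show ?thesis using degree_top root_in_V by simp
    next
      case False
      then show ?thesis
        using degree_leaf leaf_H[OF i] name_in_W[of "{i}"] name_leaf by (simp add: N_def)
    qed
  qed
  moreover have "degree F v = 3" if "v \<in> W - {1..n}" for v
  proof -
    from that have "v \<in> W" "v \<notin> {1..n}" by auto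
    then show ?thesis by (cases rule: W_cases) (use l degree_inner in auto)
  qed
  ultimately show ?thesis using is_tree by (simp add: binary_tree_graphs_def)
qed

lemma clusters_eq: "clusters n l (W, F) = H"
proof -
  interpret G: leaf_rooted W F n l using binary l n2 by unfold_locales
  have "G.C (name A) = A" if A: "A \<in> H" for A
  proof (rule set_eqI)
    fix i
    have AN: "A \<in> N" using A by (simp add: N_def)
    show "i \<in> G.C (name A) \<longleftrightarrow> i \<in> A"
    proof (cases "i \<in> {1..n}")
      case True
      show ?thesis
      proof (cases "i = l")
        case True
        have "\<not> le l (name A)"
          using le_name[of Top A] AN name_top member_H[OF A] by (auto simp: N_def)
        then show ?thesis using True member_H[OF A] G.C_iff by blast
      next
        case False
        then have "le i (name A) \<longleftrightarrow> {i} \<subseteq> A"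
          using le_name[of "{i}" A] AN name_leaf leaf_H[OF True] by (simp add: N_def)
        then show ?thesis using G.C_iff True by simp
      qed
    next
      case False
      then show ?thesis using member_H[OF A] G.C_subset unfolding Top_def by blast
    qed
  qed
  then have "G.C ` name ` H = H" unfolding image_image by simp
  then show ?thesis unfolding clusters_def W_nonroot[symmetric] by simp
qed

end

lemma clusters_surj:
  assumes "hier ({1..n} - {l}) H" "l \<in> {1..n}" "2 \<le> n"
  shows "\<exists>G\<in>binary_tree_graphs n. clusters n l G = H"
proof -
  interpret hasse n l H using assms by unfold_locales
  show ?thesis using binary clusters_eq by blast
qed

section \<open>Clusters of the induced rooted tree\<close>

definition avoid_rel :: "nat set set \<Rightarrow> nat \<Rightarrow> (nat \<times> nat) set" where
  "avoid_rel F v = {(x, y). {x, y} \<in> F \<and> x \<noteq> v \<and> y \<noteq> v}"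

text \<open>The clusters of a rooted tree, read off as an isomorphism invariant: a leaf is below \<open>v\<close> if and
  only if it cannot be reached from the root without visiting \<open>v\<close>. Reachability is used in place of
  paths because it is easier to transport from the tree to its suppressed version.\<close>

definition rooted_clusters :: "nat set \<Rightarrow> rooted_graph \<Rightarrow> nat set set" where
  "rooted_clusters S = (\<lambda>(K, F, r). (\<lambda>v. {s \<in> S. (r, s) \<notin> (avoid_rel F v)\<^sup>*}) ` K)"

lemma rooted_clusters_iso:
  assumes iso: "rooted_iso S (K, F, r) (K', F', r')"
    and wf: "\<And>e. e \<in> F \<Longrightarrow> e \<subseteq> K" "r \<in> K" "S \<subseteq> K"
  shows "rooted_clusters S (K, F, r) = rooted_clusters S (K', F', r')"
proof -
  obtain f where f: "bij_betw f K K'" "F' = (\<lambda>e. f ` e) ` F" "f r = r'" "\<forall>s\<in>S. f s = s"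
    using iso by (auto simp: rooted_iso_def)
  have inj: "inj_on f K" and surj: "f ` K = K'" using f(1) by (auto simp: bij_betw_def)
  have reach: "(r', f y) \<in> (avoid_rel F' (f v))\<^sup>* \<longleftrightarrow> (r, y) \<in> (avoid_rel F v)\<^sup>*"
    if "v \<in> K" "y \<in> K" for v y
  proof
    assume "(r, y) \<in> (avoid_rel F v)\<^sup>*"
    then show "(r', f y) \<in> (avoid_rel F' (f v))\<^sup>*"
    proof (induction rule: rtrancl_induct)
      case (step y z)
      then have e: "{y, z} \<in> F" "y \<noteq> v" "z \<noteq> v" by (auto simp: avoid_rel_def)
      have "y \<in> K" "z \<in> K" using wf(1)[OF e(1)] by auto
      then have "f y \<noteq> f v" "f z \<noteq> f v" using e inj_on_eq_iff[OF inj] that(1) by auto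
      moreover have "{f y, f z} \<in> F'" using imageI[OF e(1), of "\<lambda>e. f ` e"] by (simp add: f(2))
      ultimately have "(f y, f z) \<in> avoid_rel F' (f v)" by (simp add: avoid_rel_def)
      with step.IH show ?case by (rule rtrancl_into_rtrancl)
    qed (simp add: f(3))
  next
    have "\<exists>y\<in>K. b = f y \<and> (r, y) \<in> (avoid_rel F v)\<^sup>*"
      if "(r', b) \<in> (avoid_rel F' (f v))\<^sup>*" for b
      using that
    proof (induction rule: rtrancl_induct)
      case base
      then show ?case using f(3) wf(2) by blast
    next
      case (step b c)
      then obtain y where y: "y \<in> K" "b = f y" "(r, y) \<in> (avoid_rel F v)\<^sup>*" by blast
      have bc: "{b, c} \<in> F'" "b \<noteq> f v" "c \<noteq> f v" using step.hyps(2) by (auto simp: avoid_rel_def)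
      then obtain e where e: "e \<in> F" "f ` e = {b, c}" unfolding f(2) by blast
      have eK: "e \<subseteq> K" using wf(1) e(1) .
      have "c \<in> f ` e" using e(2) by simp
      then obtain z where z: "z \<in> e" "f z = c" by blast
      have "z \<in> K" using z(1) eK by blast
      then have "f ` e = f ` {y, z}" "{y, z} \<subseteq> K" using e(2) y(1,2) z(2) by simp_all
      then have "e = {y, z}" using inj_on_image_eq_iff[OF inj eK] by blast
      then have "(y, z) \<in> avoid_rel F v" using e(1) bc y(2) z(2) by (auto simp: avoid_rel_def)
      with y(3) have "(r, z) \<in> (avoid_rel F v)\<^sup>*" by (rule rtrancl_into_rtrancl)
      then show ?case using z(2) \<open>z \<in> K\<close> by blast
    qed
    moreover assume "(r', f y) \<in> (avoid_rel F' (f v))\<^sup>*"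
    ultimately show "(r, y) \<in> (avoid_rel F v)\<^sup>*"
      using inj_on_eq_iff[OF inj] that(2) by blast
  qed
  have "{s \<in> S. (r', s) \<notin> (avoid_rel F' (f v))\<^sup>*} = {s \<in> S. (r, s) \<notin> (avoid_rel F v)\<^sup>*}"
    if v: "v \<in> K" for v
  proof -
    have "(r', s) \<in> (avoid_rel F' (f v))\<^sup>* \<longleftrightarrow> (r, s) \<in> (avoid_rel F v)\<^sup>*" if "s \<in> S" for s
      using reach[OF v, of s] that f(4) wf(3) by auto
    then show ?thesis by blast
  qed
  then show ?thesis
    unfolding rooted_clusters_def surj[symmetric] by (simp add: image_image)
qed

lemma find_append_first:
  "\<forall>y\<in>set a. \<not> Q y \<Longrightarrow> Q x \<Longrightarrow> List.find Q (a @ x # b) = Some x"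
  by (induction a) auto

locale induced = leaf_rooted +
  fixes S :: "nat set"
  assumes S: "S \<subseteq> {1..n} - {l}" and card_S: "2 \<le> card S"
begin

lemma S_leaf: "s \<in> S \<Longrightarrow> s \<in> {1..n} \<and> s \<noteq> l \<and> s \<in> V"
  using S leaf_in_V by blast

lemma S_nonempty: "S \<noteq> {}"
  using card_S by auto

text \<open>The first vertex common to all paths is the lowest common ancestor of \<open>S\<close>. It differs from \<open>l\<close>
  because the only child of \<open>l\<close> already lies above all of \<open>S\<close>.\<close>

lemma apex_exists: "\<exists>r. r \<noteq> l \<and> (\<forall>s\<in>S. le s r) \<and> (\<forall>y. (\<forall>s\<in>S. le s y) \<longrightarrow> le r y)"
proof -
  obtain t where t: "\<And>x. child l x \<longleftrightarrow> x = t" by (rule root_child) blast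
  let ?A = "{y \<in> V. \<forall>s\<in>S. le s y}"
  have fin: "finite ?A" using finite_V by simp
  have "le s t" if "s \<in> S" for s
    using below_child[OF le_root, of s] S_leaf[OF that] t by auto
  moreover have "t \<in> V" using t[of t] by (simp add: child_def)
  ultimately have "t \<in> ?A" by blast
  then have ne: "?A \<noteq> {}" by blast
  define r where "r = arg_min_on (\<lambda>y. card {x. le x y}) ?A"
  have r: "r \<in> ?A" using arg_min_if_finite(1)[OF fin ne] by (simp add: r_def)
  have min: "\<not> card {x. le x y} < card {x. le x r}" if "y \<in> ?A" for y
    using arg_min_if_finite(2)[OF fin ne, of "\<lambda>y. card {x. le x y}"] that
    unfolding r_def by blast
  have below: "le r y" if y: "\<forall>s\<in>S. le s y" for y
  proof -
    obtain s where s: "s \<in> S" using S_nonempty by blast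
    then have "le r y \<or> le y r" using y r le_comparable by blast
    moreover have "r = y" if yr: "le y r"
    proof (rule ccontr)
      assume "r \<noteq> y"
      then have "\<not> le r y" using yr le_antisym by blast
      then have "{x. le x y} \<subset> {x. le x r}" using yr le_trans le_refl r by blast
      then have "card {x. le x y} < card {x. le x r}" using finite_below by (rule psubset_card_mono[rotated])
      moreover have "y \<in> ?A" using y yr le_in_V by blast
      ultimately show False using min by blast
    qed
    ultimately show ?thesis using le_refl r by blast
  qed
  have "le r t" using below \<open>t \<in> ?A\<close> by blast
  moreover have "child l t" using t by simp
  ultimately have "r \<noteq> l" using child_le child_neq le_antisym by blast
  then show ?thesis using r below by blast
qed

definition r :: nat where "r = (SOME r. r \<noteq> l \<and> (\<forall>s\<in>S. le s r) \<and> (\<forall>y. (\<forall>s\<in>S. le s y) \<longrightarrow> le r y))"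

lemma r_not_root: "r \<noteq> l" and S_le_r: "s \<in> S \<Longrightarrow> le s r"
  and r_least: "(\<And>s. s \<in> S \<Longrightarrow> le s y) \<Longrightarrow> le r y"
  using someI_ex[OF apex_exists] unfolding r_def[symmetric] by blast+

lemma r_in_V: "r \<in> V"
  using S_le_r S_nonempty le_in_V by blast

lemma r_not_in_S: "r \<notin> S"
proof
  assume r: "r \<in> S"
  then have "S \<subseteq> {r}" using S_le_r le_leaf S_leaf by blast
  then have "card S \<le> card {r}" by (intro card_mono) auto
  then show False using card_S by simp
qed

lemma leaf_neighbour: "child l (leaf_neighbour E l)"
proof -
  obtain t where t: "\<And>x. child l x \<longleftrightarrow> x = t" by (rule root_child) blast
  have "leaf_neighbour E l = t"
    unfolding leaf_neighbour_def edge_iff_child using t child_not_root by (intro the_equality) auto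
  then show ?thesis using t by simp
qed

lemma path_to_neighbour:
  assumes "s \<in> V" "s \<noteq> l"
  shows "tree_path E s (leaf_neighbour E l) = rev (tl (P s))"
proof -
  let ?t = "leaf_neighbour E l"
  obtain t where t: "\<And>x. child l x \<longleftrightarrow> x = t" by (rule root_child) blast
  then have "?t = t" using leaf_neighbour by blast
  then have le: "le s ?t" using below_child[OF le_root[OF assms(1)]] assms(2) t by auto
  then obtain p q where pq: "P ?t = p @ [?t]" "P s = p @ ?t # q" "tree_path E ?t s = ?t # q"
    using path_down by blast
  have "P ?t = [l, ?t]" using leaf_neighbour by (simp add: child_def)
  then have "tl (P s) = ?t # q" using pq by simp
  moreover have "is_path E ?t (?t # q) s"
    using tree_path_is_path[of ?t s] pq(3) le_in_V[OF le] by simp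
  then have "tree_path E s ?t = rev (?t # q)"
    using tree_path_eqI[OF _ _ is_path_rev] le_in_V[OF le] by blast
  ultimately show ?thesis by simp
qed

lemma set_path_to_neighbour:
  assumes "s \<in> V" "s \<noteq> l"
  shows "set (tree_path E s (leaf_neighbour E l)) = set (P s) - {l}"
proof -
  obtain q where q: "P s = l # q"
    using P_hd[OF assms(1)] P_nonempty[OF assms(1)] by (cases "P s") auto
  then have "l \<notin> set q" using P_distinct[OF assms(1)] by simp
  then show ?thesis using path_to_neighbour[OF assms] q by auto
qed

lemma first_common_vertex: "first_common_vertex E S (leaf_neighbour E l) = r"
proof -
  let ?t = "leaf_neighbour E l"
  let ?Q = "\<lambda>y. \<forall>t\<in>S. y \<in> set (tree_path E t ?t)"
  have Q: "?Q y \<longleftrightarrow> y \<noteq> l \<and> (\<forall>s\<in>S. le s y)" for y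
    using set_path_to_neighbour S_leaf S_nonempty unfolding le_def by auto
  have "List.find ?Q (tree_path E s ?t) = Some r" if s: "s \<in> S" for s
  proof -
    obtain p q where pq: "P r = p @ [r]" "P s = p @ r # q"
      using path_down[OF S_le_r[OF s]] by blast
    have "p \<noteq> []" using P_hd[OF r_in_V] pq(1) r_not_root by auto
    then have "tree_path E s ?t = rev q @ r # rev (tl p)"
      using path_to_neighbour[of s] S_leaf[OF s] pq(2) by simp
    moreover have "?Q r" using Q r_not_root S_le_r by blast
    moreover have "\<not> ?Q y" if "y \<in> set (rev q)" for y
    proof
      assume "?Q y"
      then have "le r y" using Q r_least by blast
      then have "y \<in> set (p @ [r])" by (simp add: le_def pq(1))
      moreover have "distinct (P s)" using P_distinct S_leaf[OF s] by blast
      ultimately show False using that unfolding pq(2) by auto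
    qed
    ultimately show ?thesis using find_append_first[of "rev q" ?Q r "rev (tl p)"] by simp
  qed
  then show ?thesis
    unfolding first_common_vertex_def using S_nonempty by (intro the_equality) force+
qed

definition W where "W = (\<Union>s\<in>S. set (tree_path E r s))"
definition F0 where "F0 = (\<Union>s\<in>S. path_edges (tree_path E r s))"
definition K where "K = {x \<in> W. x = r \<or> degree F0 x \<noteq> 2}"
definition F where "F = {{x, y} | x y. x \<noteq> y \<and> (\<exists>p. is_path F0 x p y \<and> set p \<inter> K = {x, y})}"

lemma induced_rooted_graph_eq: "induced_rooted_graph l S (V, E) = (K, F, r)"
  unfolding induced_rooted_graph_def suppress_def K_def F_def W_def F0_def
  by (simp add: Let_def first_common_vertex)

lemma mem_path_from_r:
  assumes s: "s \<in> S" shows "y \<in> set (tree_path E r s) \<longleftrightarrow> le y r \<and> le s y"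
proof -
  obtain p q where pq: "P r = p @ [r]" "P s = p @ r # q" "tree_path E r s = r # q"
    using path_down[OF S_le_r[OF s]] by blast
  have sV: "s \<in> V" using S_leaf[OF s] by blast
  have dist: "distinct (P s)" using P_distinct[OF sV] .
  have mem: "le s y \<longleftrightarrow> y \<in> set (p @ r # q)" for y using sV by (simp add: le_def pq(2))
  have memr: "le r y \<longleftrightarrow> y \<in> set (p @ [r])" for y using r_in_V by (simp add: le_def pq(1))
  show ?thesis
  proof
    assume "y \<in> set (tree_path E r s)"
    then have y: "y \<in> set (r # q)" by (simp add: pq(3))
    then have sy: "le s y" using mem by auto
    have "y = r" if "le r y" using that y dist unfolding memr pq(2) by auto
    then have "le y r" using le_comparable[OF sy S_le_r[OF s]] le_refl[OF r_in_V] by blast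
    then show "le y r \<and> le s y" using sy by blast
  next
    assume a: "le y r \<and> le s y"
    then have "y \<in> set (p @ r # q)" using mem by blast
    moreover have "y = r" if "y \<in> set p"
    proof -
      have "le r y" using that memr by simp
      then show ?thesis using a le_antisym by blast
    qed
    ultimately show "y \<in> set (tree_path E r s)" by (auto simp: pq(3))
  qed
qed

lemma W_iff: "y \<in> W \<longleftrightarrow> le y r \<and> (\<exists>s\<in>S. le s y)"
  unfolding W_def using mem_path_from_r by blast

lemma tree_path_r: "s \<in> S \<Longrightarrow> is_path E r (tree_path E r s) s"
  using tree_path_is_path r_in_V S_leaf by blast

lemma F0_subset: "F0 \<subseteq> E"
  unfolding F0_def using is_path_path_edges(2)[OF tree_path_r] by blast

lemma path_F0: "s \<in> S \<Longrightarrow> is_path F0 r (tree_path E r s) s"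
  by (rule is_path_mono[OF is_path_path_edges(1)[OF tree_path_r]]) (auto simp: F0_def)

lemma edge_in_F0:
  assumes "child u c" "c \<in> W" "c \<noteq> r" shows "{u, c} \<in> F0"
proof -
  obtain s where s: "s \<in> S" "le s c" and cr: "le c r" using assms(2) W_iff by blast
  have ur: "le u r" using le_child_iff[OF assms(1), of r] cr assms(3) by auto
  obtain p q where pq: "P r = p @ [r]" "P s = p @ r # q" "tree_path E r s = r # q"
    using path_down[OF S_le_r[OF s(1)]] by blast
  obtain z where z: "P s = P c @ z" using s(2) unfolding le_alt by (auto elim: prefixE)
  obtain b where b: "P u = P r @ b" using ur unfolding le_alt by (auto elim: prefixE)
  have Pc: "P c = P u @ [c]" using assms(1) by (simp add: child_def)
  have "r # q = (r # b) @ c # z" using z Pc b pq by simp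
  moreover have "last (r # b) = u"
    using b P_last[of u] assms(1) pq(1) by (auto simp: child_def split: if_splits)
  then have "r # b = butlast (r # b) @ [u]" by (metis append_butlast_last_id list.simps(3))
  ultimately have "tree_path E r s = butlast (r # b) @ u # c # z"
    using pq(3) by (metis append.assoc append_Cons append_Nil)
  then show ?thesis using path_edges_append_pair s(1) unfolding F0_def by (metis UN_iff)
qed

lemma S_in_K: "s \<in> S \<Longrightarrow> s \<in> K"
proof -
  assume s: "s \<in> S"
  have one: "card {e \<in> E. s \<in> e} = 1" using leaf_degree S_leaf[OF s] by (simp add: degree_def)
  then have "finite {e \<in> E. s \<in> e}" by (intro card_ge_0_finite) simp
  moreover have "{e \<in> F0. s \<in> e} \<subseteq> {e \<in> E. s \<in> e}" using F0_subset by blast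
  ultimately have "degree F0 s \<le> 1" unfolding degree_def one[symmetric] by (rule card_mono)
  moreover have "s \<in> W" using W_iff S_le_r[OF s] le_refl S_leaf[OF s] s by blast
  ultimately show ?thesis by (simp add: K_def)
qed

lemma r_in_K: "r \<in> K"
  using W_iff le_refl[OF r_in_V] S_le_r S_nonempty unfolding K_def by blast

lemma K_W: "v \<in> K \<Longrightarrow> v \<in> W"
  by (simp add: K_def)

lemma F_sub_K: "e \<in> F \<Longrightarrow> e \<subseteq> K"
  unfolding F_def by blast

lemma path_E: "is_path F0 x p y \<Longrightarrow> is_path E x p y"
  using F0_subset by (auto intro: is_path_mono)

text \<open>An edge of the suppressed tree stands for a path of the original tree whose interior avoids \<open>K\<close>. If
  that path entered the part below \<open>v\<close> it would contain \<open>v\<close> by \<open>path_crossing\<close>, but \<open>v\<close> is kept.\<close>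

lemma F_crossing:
  assumes "{x, y} \<in> F" "v \<in> K" "x \<noteq> v" "y \<noteq> v" "le y v" shows "le x v"
proof (rule ccontr)
  assume not: "\<not> le x v"
  obtain a b p where ab: "{x, y} = {a, b}" "is_path F0 a p b" "set p \<inter> K = {a, b}"
    using assms(1) unfolding F_def by blast
  have "\<exists>q. is_path E x q y \<and> set q = set p"
  proof (cases "x = a")
    case True
    then have "y = b" using ab(1) by (auto simp: doubleton_eq_iff)
    then show ?thesis using True ab(2) path_E by blast
  next
    case False
    then have "x = b" "y = a" using ab(1) by (auto simp: doubleton_eq_iff)
    then show ?thesis using is_path_rev[OF path_E[OF ab(2)]] by (metis set_rev)
  qed
  then have "v \<in> set p" using path_crossing not assms(5) by blast
  then have "v \<in> {x, y}" unfolding ab(1) ab(3)[symmetric] using assms(2) by simp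
  then show False using assms(3,4) by simp
qed

text \<open>The descending path to \<open>s\<close> meets only ancestors of \<open>s\<close>, so it avoids \<open>v\<close>; jumping from each kept
  vertex to the next kept one turns it into a walk in the suppressed tree.\<close>

lemma reach_leaf:
  assumes "s \<in> S" "\<not> le s v" "x \<in> K" "tree_path E r s = a @ x # q"
  shows "(x, s) \<in> (avoid_rel F v)\<^sup>*"
  using assms(3,4)
proof (induction "length q" arbitrary: a x q rule: less_induct)
  case less
  have dist: "distinct (a @ x # q)" and last: "last (a @ x # q) = s"
    using tree_path_r[OF assms(1)] less.prems(2) by (auto simp: is_path_def)
  have neq: "y \<noteq> v" if "y \<in> set (a @ x # q)" for y
    using that mem_path_from_r[OF assms(1), of y] assms(2) less.prems(2) by auto
  show ?case
  proof (cases q)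
    case Nil
    then show ?thesis using last by simp
  next
    case (Cons q0 qs)
    then have "s \<in> set q" using last by (auto split: if_splits)
    then have "\<exists>y\<in>set q. y \<in> K" using S_in_K assms(1) by blast
    then obtain b y c where q: "q = b @ y # c" "y \<in> K" "\<forall>z\<in>set b. z \<notin> K"
      using split_list_first_prop[of q "\<lambda>y. y \<in> K"] by blast
    have p: "is_path F0 r (a @ x # b @ y # c) s"
      using path_F0[OF assms(1)] less.prems(2) q(1) by simp
    have "is_path F0 x (x # b @ y # c) s" using is_path_appendD(2)[OF p] .
    then have "is_path F0 x ((x # b) @ y # c) s" by simp
    then have "is_path F0 x ((x # b) @ [y]) y" by (rule is_path_appendD(1))
    moreover have "set ((x # b) @ [y]) \<inter> K = {x, y}" using q(2,3) less.prems(1) by auto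
    moreover have "x \<noteq> y" using dist q(1) by auto
    ultimately have "{x, y} \<in> F" unfolding F_def by blast
    then have "(x, y) \<in> avoid_rel F v" using neq[of x] neq[of y] q(1) by (simp add: avoid_rel_def)
    moreover have "(y, s) \<in> (avoid_rel F v)\<^sup>*"
    proof (rule less.hyps)
      show "length c < length q" using q(1) by simp
      show "tree_path E r s = (a @ x # b) @ y # c" using less.prems(2) q(1) by simp
    qed (rule q(2))
    ultimately show ?thesis by (rule converse_rtrancl_into_rtrancl)
  qed
qed

lemma cluster_in_K:
  assumes v: "v \<in> K" shows "{s \<in> S. (r, s) \<notin> (avoid_rel F v)\<^sup>*} = C v \<inter> S"
proof -
  have "(r, s) \<in> (avoid_rel F v)\<^sup>* \<longleftrightarrow> \<not> le s v" if s: "s \<in> S" for s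
  proof
    assume "\<not> le s v"
    have "is_path E r (tree_path E r s) s" using tree_path_r[OF s] .
    then obtain q where "tree_path E r s = [] @ r # q" by (cases "tree_path E r s") (auto simp: is_path_def)
    then show "(r, s) \<in> (avoid_rel F v)\<^sup>*" using reach_leaf[OF s \<open>\<not> le s v\<close> r_in_K] by blast
  next
    assume reach: "(r, s) \<in> (avoid_rel F v)\<^sup>*"
    have rs: "r \<noteq> s" using s r_not_in_S by blast
    show "\<not> le s v"
    proof (cases "v = r")
      case True
      then have "(r, s) \<notin> (avoid_rel F v)\<^sup>*"
        using rs by (auto simp: avoid_rel_def elim: converse_rtranclE)
      then show ?thesis using reach by blast
    next
      case False
      have "le v r" using v K_W W_iff by blast
      then have "\<not> le r v" using False le_antisym by blast
      from reach show ?thesis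
      proof (induction rule: rtrancl_induct)
        case (step y z)
        then have "{y, z} \<in> F" "y \<noteq> v" "z \<noteq> v" by (auto simp: avoid_rel_def)
        then show ?case using F_crossing[OF _ v] step.IH by blast
      qed (rule \<open>\<not> le r v\<close>)
    qed
  qed
  then show ?thesis using C_iff S_leaf by blast
qed

text \<open>Suppression loses no cluster. Among the vertices with a given trace on \<open>S\<close> take the lowest one. It
  is a leaf in \<open>S\<close>, or both of its children have leaves of \<open>S\<close> below them and it keeps all its
  edges, unless it is the apex, which is kept anyway.\<close>

lemma branching_in_K:
  assumes "v \<in> V - {l}" "C v \<inter> S \<noteq> {}"
  shows "\<exists>u\<in>K. C u \<inter> S = C v \<inter> S"
proof -
  let ?A = "{u \<in> V - {l}. C u \<inter> S = C v \<inter> S}"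
  have fin: "finite ?A" and ne: "?A \<noteq> {}" using finite_V assms(1) by auto
  define u where "u = arg_min_on (\<lambda>y. card {x. le x y}) ?A"
  have u: "u \<in> V" "u \<noteq> l" "C u \<inter> S = C v \<inter> S"
    using arg_min_if_finite(1)[OF fin ne] by (auto simp: u_def)
  have min: "\<not> card {x. le x y} < card {x. le x u}" if "y \<in> ?A" for y
    using arg_min_if_finite(2)[OF fin ne, of "\<lambda>y. card {x. le x y}"] that
    unfolding u_def by blast
  obtain s where s: "s \<in> S" "le s u" using assms(2) u(3) C_iff by blast
  have ur: "le u r"
  proof (rule ccontr)
    assume not: "\<not> le u r"
    then have ru: "le r u" "r \<noteq> u" using le_comparable[OF s(2) S_le_r[OF s(1)]] le_refl u(1) by auto
    then have "S \<subseteq> C u" "S \<subseteq> C r" using C_iff S_leaf S_le_r le_trans by blast+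
    then have "r \<in> ?A" using u r_in_V r_not_root by blast
    moreover have "{x. le x r} \<subset> {x. le x u}" using ru not le_trans le_refl[OF u(1)] by blast
    then have "card {x. le x r} < card {x. le x u}" by (rule psubset_card_mono[OF finite_below])
    ultimately show False using min by blast
  qed
  then have uW: "u \<in> W" using s W_iff by blast
  have "u \<in> K"
  proof (cases "u = r")
    case False
    show ?thesis
    proof (cases "u \<in> {1..n}")
      case True
      then have "s = u" using le_leaf s u(2) by blast
      then show ?thesis using S_in_K s by blast
    next
      case inner: False
      obtain c d where cd: "c \<noteq> d" "\<And>x. child u x \<longleftrightarrow> x = c \<or> x = d"
        by (rule inner_children[OF u(1) inner]) blast
      have down: "{u, c} \<in> F0" if cd: "c \<noteq> d" "\<And>x. child u x \<longleftrightarrow> x = c \<or> x = d" for c d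
      proof -
        have ch: "child u c" "child u d" using cd by simp_all
        have "C c \<inter> S \<noteq> {}"
        proof
          assume empty: "C c \<inter> S = {}"
          have "C d \<inter> S = C u \<inter> S"
          proof (intro equalityI subsetI)
            fix i assume i: "i \<in> C u \<inter> S"
            then have "i \<noteq> u" "le i u" using inner S_leaf C_iff by blast+
            then obtain x where "child u x" "le i x" using below_child by blast
            then have "le i c \<or> le i d" using cd(2) by auto
            then show "i \<in> C d \<inter> S" using i empty C_iff S_leaf by blast
          qed (use C_mono[OF child_le[OF ch(2)]] in blast)
          then have "d \<in> ?A" using u(3) ch(2) child_not_root by (auto simp: child_def)
          then show False using min below_child_card[OF ch(2)] by blast
        qed
        then obtain i where "i \<in> S" "le i c" using C_iff by blast
        moreover have "le c r" using child_le[OF ch(1)] ur le_trans by blast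
        ultimately have "c \<in> W" using W_iff by blast
        moreover have "c \<noteq> r" using child_le[OF ch(1)] child_neq[OF ch(1)] ur le_antisym by blast
        ultimately show ?thesis using edge_in_F0 ch(1) by blast
      qed
      obtain w where w: "child w u" using parent_exists u by blast
      have "{w, u} \<in> F0" using edge_in_F0[OF w uW False] .
      moreover have "{u, c} \<in> F0" "{u, d} \<in> F0" using down[OF cd] down[of d c] cd by auto
      moreover have "{e \<in> E. u \<in> e} = {{w, u}, {u, c}, {u, d}}"
        using edges_at[OF w] cd(2) by auto
      ultimately have "{e \<in> E. u \<in> e} \<subseteq> F0" by simp
      then have "{e \<in> F0. u \<in> e} = {e \<in> E. u \<in> e}" using F0_subset by blast
      then have "degree F0 u = 3" using inner_degree[OF u(1) inner] by (simp add: degree_def)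
      then show ?thesis using uW by (simp add: K_def)
    qed
  qed (simp add: r_in_K)
  then show ?thesis using u(3) by blast
qed

lemma rooted_clusters_induced:
  "rooted_clusters S (induced_rooted_graph l S (V, E)) = restrict_hier S (clusters n l (V, E))"
proof -
  have "(\<lambda>v. C v \<inter> S) ` K = (\<lambda>A. A \<inter> S) ` (C ` (V - {l})) - {{}}"
  proof (intro equalityI subsetI)
    fix A assume "A \<in> (\<lambda>v. C v \<inter> S) ` K"
    then obtain v where v: "v \<in> K" "A = C v \<inter> S" by blast
    then have vr: "le v r" and "\<exists>s\<in>S. le s v" using K_W W_iff by blast+
    then have "A \<noteq> {}" using v C_iff S_leaf by blast
    moreover have "v \<noteq> l" using vr r_not_root le_root[OF r_in_V] le_antisym by blast
    then have "v \<in> V - {l}" using vr le_in_V by blast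
    ultimately show "A \<in> (\<lambda>A. A \<inter> S) ` (C ` (V - {l})) - {{}}" using v(2) by blast
  next
    fix A assume "A \<in> (\<lambda>A. A \<inter> S) ` (C ` (V - {l})) - {{}}"
    then obtain v where v: "v \<in> V - {l}" "A = C v \<inter> S" "A \<noteq> {}" by blast
    then obtain u where "u \<in> K" "C u \<inter> S = C v \<inter> S" using branching_in_K[of v] by metis
    then show "A \<in> (\<lambda>v. C v \<inter> S) ` K" unfolding v(2) by (metis imageI)
  qed
  then show ?thesis
    unfolding induced_rooted_graph_eq restrict_hier_def
    by (simp add: rooted_clusters_def clusters_def cluster_in_K)
qed

lemma rooted_clusters_of_iso:
  "rooted_iso S (induced_rooted_graph l S (V, E)) R \<Longrightarrow>
    rooted_clusters S R = restrict_hier S (clusters n l (V, E))"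
proof -
  assume iso: "rooted_iso S (induced_rooted_graph l S (V, E)) R"
  obtain K' F' r' where R: "R = (K', F', r')" by (cases R)
  show ?thesis
    using rooted_clusters_iso[of S K F r K' F' r'] F_sub_K r_in_K S_in_K iso
    unfolding rooted_clusters_induced[symmetric] induced_rooted_graph_eq R by auto
qed

lemma induced_reflexive:
  "rooted_iso S (induced_rooted_graph l S (V, E)) (induced_rooted_graph l S (V, E))"
  unfolding induced_rooted_graph_eq rooted_iso_def by (auto intro!: exI[of _ id])

end

section \<open>Isomorphism classes\<close>

lemma leaf_rootedI:
  assumes "(V, E) \<in> binary_tree_graphs n" "l \<in> {1..n}" "2 \<le> n"
  shows "leaf_rooted V E n l"
  using assms by unfold_locales

lemma iso_rel_iff:
  assumes "l \<in> {1..n}" "2 \<le> n"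
  shows "(G, H) \<in> iso_rel n \<longleftrightarrow> G \<in> binary_tree_graphs n \<and> H \<in> binary_tree_graphs n \<and>
    clusters n l G = clusters n l H"
proof -
  obtain V E V' E' where GH: "G = (V, E)" "H = (V', E')" by (cases G, cases H)
  show ?thesis
    using clusters_iso[of V E n l V' E'] clusters_eq_imp_iso[of V E n l V' E']
      leaf_rootedI[OF _ assms, of V E] leaf_rootedI[OF _ assms, of V' E']
    unfolding iso_rel_def GH by blast
qed

lemma clusters_image:
  assumes "l \<in> {1..n}" "2 \<le> n"
  shows "clusters n l ` binary_tree_graphs n = {H. hier ({1..n} - {l}) H}"
proof (intro equalityI subsetI)
  fix H assume "H \<in> clusters n l ` binary_tree_graphs n"
  then obtain V E where "(V, E) \<in> binary_tree_graphs n" "H = clusters n l (V, E)" by auto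
  then show "H \<in> {H. hier ({1..n} - {l}) H}"
    using leaf_rooted.hier_clusters[OF leaf_rootedI[OF _ assms]] by blast
next
  fix H assume "H \<in> {H. hier ({1..n} - {l}) H}"
  then show "H \<in> clusters n l ` binary_tree_graphs n"
    using clusters_surj[OF _ assms] by blast
qed

text \<open>All members of an isomorphism class have the same clusters, so the image is a singleton.\<close>

definition class_clusters :: "nat \<Rightarrow> nat \<Rightarrow> graph set \<Rightarrow> nat set set" where
  "class_clusters n l T = the_elem (clusters n l ` T)"

lemma unrooted_tree_class:
  assumes "l \<in> {1..n}" "2 \<le> n" "T \<in> unrooted_trees n"
  shows "T \<noteq> {}" "G \<in> T \<Longrightarrow> G \<in> binary_tree_graphs n"
    "G \<in> T \<Longrightarrow> class_clusters n l T = clusters n l G"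
    "T = {G \<in> binary_tree_graphs n. clusters n l G = class_clusters n l T}"
proof -
  obtain G0 where G0: "G0 \<in> binary_tree_graphs n" "T = iso_rel n `` {G0}"
    using assms(3) unfolding unrooted_trees_def by (auto elim: quotientE)
  have T: "T = {G \<in> binary_tree_graphs n. clusters n l G = clusters n l G0}"
  proof (rule set_eqI)
    fix G
    have "G \<in> T \<longleftrightarrow> (G0, G) \<in> iso_rel n" unfolding G0(2) by simp
    then show "G \<in> T \<longleftrightarrow> G \<in> {G \<in> binary_tree_graphs n. clusters n l G = clusters n l G0}"
      unfolding iso_rel_iff[OF assms(1,2)] using G0(1) by (simp add: eq_commute)
  qed
  have "clusters n l ` T = {clusters n l G0}" unfolding T using G0(1) by auto
  then have c: "class_clusters n l T = clusters n l G0" by (simp add: class_clusters_def)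
  show "T \<noteq> {}" "G \<in> T \<Longrightarrow> G \<in> binary_tree_graphs n"
    "G \<in> T \<Longrightarrow> class_clusters n l T = clusters n l G"
    using T c G0(1) by blast+
  show "T = {G \<in> binary_tree_graphs n. clusters n l G = class_clusters n l T}"
    unfolding c by (rule T)
qed

lemma bij_class_clusters:
  assumes "l \<in> {1..n}" "2 \<le> n"
  shows "bij_betw (class_clusters n l) (unrooted_trees n) {H. hier ({1..n} - {l}) H}"
proof (rule bij_betw_imageI)
  show "inj_on (class_clusters n l) (unrooted_trees n)"
  proof (rule inj_onI)
    fix T T' assume T: "T \<in> unrooted_trees n" "T' \<in> unrooted_trees n"
      and eq: "class_clusters n l T = class_clusters n l T'"
    have "T = {G \<in> binary_tree_graphs n. clusters n l G = class_clusters n l T}"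
      by (rule unrooted_tree_class(4)[OF assms T(1)])
    also have "\<dots> = {G \<in> binary_tree_graphs n. clusters n l G = class_clusters n l T'}"
      by (simp only: eq)
    also have "\<dots> = T'" by (rule unrooted_tree_class(4)[OF assms T(2), symmetric])
    finally show "T = T'" .
  qed
  show "class_clusters n l ` unrooted_trees n = {H. hier ({1..n} - {l}) H}"
    unfolding clusters_image[OF assms, symmetric]
  proof (intro equalityI subsetI)
    fix H assume "H \<in> class_clusters n l ` unrooted_trees n"
    then obtain T where T: "T \<in> unrooted_trees n" "H = class_clusters n l T" by blast
    then obtain G where "G \<in> T" using unrooted_tree_class(1)[OF assms T(1)] by blast
    then show "H \<in> clusters n l ` binary_tree_graphs n"
      using unrooted_tree_class(2,3)[OF assms T(1)] T(2) by blast
  next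
    fix H assume "H \<in> clusters n l ` binary_tree_graphs n"
    then obtain G where G: "G \<in> binary_tree_graphs n" "H = clusters n l G" by blast
    let ?T = "iso_rel n `` {G}"
    have T: "?T \<in> unrooted_trees n" unfolding unrooted_trees_def using G(1) by (rule quotientI)
    have "G \<in> ?T" using iso_rel_iff[OF assms] G(1) by blast
    then have "class_clusters n l ?T = H" using unrooted_tree_class(3)[OF assms T] G(2) by simp
    then show "H \<in> class_clusters n l ` unrooted_trees n" using T by blast
  qed
qed

lemma unrooted_trees_finite_nonempty:
  assumes "2 \<le> n" shows "finite (unrooted_trees n)" "unrooted_trees n \<noteq> {}"
proof -
  have l: "1 \<in> {1..n}" using assms by simp
  note bij = bij_class_clusters[OF l assms]
  show "finite (unrooted_trees n)"
    using bij_betw_finite[OF bij] finite_hiers[of "{1..n} - {1}"] by simp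
  have ne: "{1..n} - {1} \<noteq> {}" using assms by (auto simp: set_eq_iff intro!: exI[of _ 2])
  have "num_hier k > 0" for k by (auto simp: num_hier_def)
  then have "card {H. hier ({1..n} - {1}) H} \<noteq> 0"
    using card_hiers[OF _ ne] by simp
  then show "unrooted_trees n \<noteq> {}" using bij_betw_same_card[OF bij] by auto
qed

lemma induced_rooted_tree_eqD:
  assumes S: "S \<subseteq> {1..n}" "2 \<le> card S" and l: "l \<in> {1..n} - S"
    and T: "T \<in> unrooted_trees n" "T' \<in> unrooted_trees n"
    and eq: "induced_rooted_tree l S T = induced_rooted_tree l S T'"
  shows "restrict_hier S (class_clusters n l T) = restrict_hier S (class_clusters n l T')"
proof -
  have l': "l \<in> {1..n}" using l by simp
  have n2: "2 \<le> n" using S card_mono[of "{1..n}" S] by simp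
  have ind: "induced V E n l S" if "(V, E) \<in> binary_tree_graphs n" for V E
    using that l S n2 by unfold_locales auto
  have val: "rooted_clusters S R = restrict_hier S (class_clusters n l T)"
    if T: "T \<in> unrooted_trees n" and R: "R \<in> induced_rooted_tree l S T" for T R
  proof -
    obtain V E where G: "(V, E) \<in> T" "rooted_iso S (induced_rooted_graph l S (V, E)) R"
      using R by (auto simp: induced_rooted_tree_def)
    then show ?thesis
      using induced.rooted_clusters_of_iso[OF ind] unrooted_tree_class(2,3)[OF l' n2 T] by metis
  qed
  obtain V E where G: "(V, E) \<in> T" using unrooted_tree_class(1)[OF l' n2 T(1)] by auto
  then have "induced V E n l S" using ind unrooted_tree_class(2)[OF l' n2 T(1)] by blast
  then have "induced_rooted_graph l S (V, E) \<in> induced_rooted_tree l S T"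
    using induced.induced_reflexive G unfolding induced_rooted_tree_def by blast
  then show ?thesis using val T eq by metis
qed

section \<open>The probability of a shared subtree\<close>

text \<open>For each \<open>T\<close>, the trees \<open>T'\<close> with the same restricted clusters form a fibre of the restriction
  map, which is the fraction \<open>1 / num_hier (card S)\<close> of all trees.\<close>

lemma card_pairs_same_induced:
  assumes S: "S \<subseteq> {1..n}" "2 \<le> card S" and l: "l \<in> {1..n} - S"
  defines "U \<equiv> unrooted_trees n"
  shows "card {(T, T') \<in> U \<times> U. induced_rooted_tree l S T = induced_rooted_tree l S T'} *
    num_hier (card S) \<le> card U * card U"
proof -
  have l': "l \<in> {1..n}" using l by simp
  have n2: "2 \<le> n" using S card_mono[of "{1..n}" S] by simp
  let ?X = "{1..n} - {l}"
  let ?\<phi> = "class_clusters n l"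
  have bij: "bij_betw ?\<phi> U {H. hier ?X H}" unfolding U_def by (rule bij_class_clusters[OF l' n2])
  have fin: "finite U" unfolding U_def by (rule unrooted_trees_finite_nonempty[OF n2])
  have SX: "S \<subseteq> ?X" using S l by blast
  define B where "B T = {T' \<in> U. restrict_hier S (?\<phi> T') = restrict_hier S (?\<phi> T)}" for T
  have B: "card (B T) * num_hier (card S) = card U" if T: "T \<in> U" for T
  proof -
    let ?h = "restrict_hier S (?\<phi> T)"
    have "hier ?X (?\<phi> T)" using bij T by (auto simp: bij_betw_def)
    moreover have "?X \<inter> S = S" "S \<noteq> {}" using SX S by auto
    ultimately have h: "hier S ?h" using hier_restrict[of ?X "?\<phi> T" S] by simp
    have "bij_betw ?\<phi> (B T) {H. hier ?X H \<and> restrict_hier S H = ?h}"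
    proof (rule bij_betw_subset[OF bij])
      show "B T \<subseteq> U" by (auto simp: B_def)
      have "?\<phi> ` U = {H. hier ?X H}" using bij by (simp add: bij_betw_def)
      moreover have "?\<phi> ` B T = {H \<in> ?\<phi> ` U. restrict_hier S H = ?h}"
        unfolding B_def by (rule set_eqI) (simp add: image_iff, blast)
      ultimately show "?\<phi> ` B T = {H. hier ?X H \<and> restrict_hier S H = ?h}" by simp
    qed
    then show ?thesis
      using card_restrict_fibre_mult[OF h _ SX] bij_betw_same_card[OF bij]
      by (simp add: bij_betw_same_card)
  qed
  have "{(T, T') \<in> U \<times> U. induced_rooted_tree l S T = induced_rooted_tree l S T'} \<subseteq> (SIGMA T:U. B T)"
    using induced_rooted_tree_eqD[OF S l] unfolding U_def B_def by auto
  moreover have finB: "finite (B T)" for T using fin by (simp add: B_def)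
  ultimately have "card {(T, T') \<in> U \<times> U. induced_rooted_tree l S T = induced_rooted_tree l S T'}
      \<le> card (SIGMA T:U. B T)"
    using fin by (intro card_mono finite_SigmaI) auto
  also have "\<dots> = (\<Sum>T\<in>U. card (B T))" using fin finB by (simp add: card_SigmaI)
  finally have "card {(T, T') \<in> U \<times> U. induced_rooted_tree l S T = induced_rooted_tree l S T'} *
      num_hier (card S) \<le> (\<Sum>T\<in>U. card (B T)) * num_hier (card S)"
    by (rule mult_right_mono) simp
  also have "\<dots> = (\<Sum>T\<in>U. card (B T) * num_hier (card S))" by (rule sum_distrib_right)
  also have "\<dots> = card U * card U" using B by simp
  finally show ?thesis .
qed

lemma pair_pmf_of_set:
  assumes "finite A" "A \<noteq> {}" "finite B" "B \<noteq> {}"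
  shows "pair_pmf (pmf_of_set A) (pmf_of_set B) = pmf_of_set (A \<times> B)"
proof (rule pmf_eqI)
  fix z
  show "pmf (pair_pmf (pmf_of_set A) (pmf_of_set B)) z = pmf (pmf_of_set (A \<times> B)) z"
    using assms by (cases z) (simp add: pmf_pair card_cartesian_product indicator_def)
qed

lemma num_hier_pos: "num_hier k > 0"
  by (auto simp: num_hier_def)

lemma prob_same_induced:
  assumes S: "S \<subseteq> {1..n}" "2 \<le> card S" and l: "l \<in> {1..n} - S"
  shows "measure_pmf.prob (pair_pmf (uniform_tree n) (uniform_tree n))
      {(T, T'). induced_rooted_tree l S T = induced_rooted_tree l S T'} \<le> 1 / num_hier (card S)"
proof -
  let ?U = "unrooted_trees n"
  have "2 \<le> n" using S card_mono[of "{1..n}" S] by simp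
  note U = unrooted_trees_finite_nonempty[OF this]
  let ?c = "card {(T, T') \<in> ?U \<times> ?U. induced_rooted_tree l S T = induced_rooted_tree l S T'}"
  have "(?U \<times> ?U) \<inter> {(T, T'). induced_rooted_tree l S T = induced_rooted_tree l S T'} =
      {(T, T') \<in> ?U \<times> ?U. induced_rooted_tree l S T = induced_rooted_tree l S T'}" by auto
  then have "measure_pmf.prob (pair_pmf (uniform_tree n) (uniform_tree n))
      {(T, T'). induced_rooted_tree l S T = induced_rooted_tree l S T'} =
      real ?c / real (card ?U * card ?U)"
    unfolding uniform_tree_def pair_pmf_of_set[OF U U]
    using U by (subst measure_pmf_of_set) (simp_all add: card_cartesian_product)
  also have "\<dots> \<le> 1 / num_hier (card S)"
  proof -
    have "real (?c * num_hier (card S)) \<le> real (card ?U * card ?U)"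
      using card_pairs_same_induced[OF S l] by (simp only: of_nat_le_iff)
    moreover have "card ?U > 0" using U by (simp add: card_gt_0_iff)
    ultimately show ?thesis using num_hier_pos[of "card S"] by (simp add: field_simps)
  qed
  finally show ?thesis .
qed

lemma prob_large_common_subtree:
  fixes t :: real
  assumes ls: "\<And>S. S \<subseteq> {1..n} \<Longrightarrow> 1 < card S \<Longrightarrow> card S < n \<Longrightarrow> ls S \<in> {1..n} - S"
    and "1 \<le> t"
  shows "measure_pmf.prob (pair_pmf (uniform_tree n) (uniform_tree n))
      {(T', T''). real (max_common_subtree ls n T' T'') > t}
    \<le> (\<Sum>k | k < n \<and> t < real k. real (n choose k) / real (num_hier k))"
proof -
  let ?pr = "measure_pmf.prob (pair_pmf (uniform_tree n) (uniform_tree n))"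
  let ?E = "\<lambda>S. {(T', T''). induced_rooted_tree (ls S) S T' = induced_rooted_tree (ls S) S T''}"
  define \<S> where "\<S> = {S. S \<subseteq> {1..n} \<and> card S < n \<and> t < real (card S)}"
  have finS: "finite \<S>" by (rule finite_subset[of _ "Pow {1..n}"]) (auto simp: \<S>_def)
  have big: "1 < card S" if "S \<in> \<S>" for S using that assms(2) by (auto simp: \<S>_def)
  have "{(T', T''). real (max_common_subtree ls n T' T'') > t} \<subseteq> (\<Union>S\<in>\<S>. ?E S)"
  proof clarify
    fix T' T'' assume gt: "real (max_common_subtree ls n T' T'') > t"
    let ?A = "{card S | S. S \<subseteq> {1..n} \<and> 1 < card S \<and> card S < n \<and>
        induced_rooted_tree (ls S) S T' = induced_rooted_tree (ls S) S T''}"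
    have "finite ?A" by (rule finite_subset[of _ "{..<n}"]) auto
    then have "max_common_subtree ls n T' T'' \<in> insert 1 ?A"
      unfolding max_common_subtree_def by (intro Max_in) auto
    \<comment> \<open>The default value 1 does not exceed \<open>t\<close>, so the maximum comes from a set.\<close>
    moreover have "max_common_subtree ls n T' T'' \<noteq> 1" using gt assms(2) by auto
    ultimately obtain S where "S \<subseteq> {1..n}" "card S < n" "max_common_subtree ls n T' T'' = card S"
      "induced_rooted_tree (ls S) S T' = induced_rooted_tree (ls S) S T''" by auto
    then show "(T', T'') \<in> (\<Union>S\<in>\<S>. ?E S)" using gt by (auto simp: \<S>_def)
  qed
  then have "?pr {(T', T''). real (max_common_subtree ls n T' T'') > t} \<le> ?pr (\<Union>S\<in>\<S>. ?E S)"
    by (intro measure_pmf.finite_measure_mono) auto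
  also have "\<dots> \<le> (\<Sum>S\<in>\<S>. ?pr (?E S))"
    using finS by (intro measure_UNION_le) auto
  also have "\<dots> \<le> (\<Sum>S\<in>\<S>. 1 / real (num_hier (card S)))"
  proof (rule sum_mono)
    fix S assume S: "S \<in> \<S>"
    show "?pr (?E S) \<le> 1 / real (num_hier (card S))"
      using big[OF S] ls[of S] S by (intro prob_same_induced) (auto simp: \<S>_def)
  qed
  also have "\<dots> = (\<Sum>k | k < n \<and> t < real k. \<Sum>S | S \<in> \<S> \<and> card S = k. 1 / real (num_hier (card S)))"
    by (rule sum.group[symmetric]) (use finS in \<open>auto simp: \<S>_def\<close>)
  also have "\<dots> = (\<Sum>k | k < n \<and> t < real k. real (n choose k) / real (num_hier k))"
  proof (rule sum.cong[OF refl])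
    fix k assume "k \<in> {k. k < n \<and> t < real k}"
    then have "{S. S \<in> \<S> \<and> card S = k} = {S. S \<subseteq> {1..n} \<and> card S = k}" by (auto simp: \<S>_def)
    then have "card {S. S \<in> \<S> \<and> card S = k} = n choose k" using n_subsets[of "{1..n}" k] by simp
    then show "(\<Sum>S | S \<in> \<S> \<and> card S = k. 1 / real (num_hier (card S))) =
        real (n choose k) / real (num_hier k)" by simp
  qed
  finally show ?thesis .
qed

section \<open>Asymptotics\<close>

text \<open>Multiplying \<open>(2 k - 1)!!\<close> by \<open>k!\<close> at once yields a single factorial, so that no asymptotics of the
  double factorial is required.\<close>

lemma num_hier_fact: "num_hier (Suc k) * fact k * 2 ^ k = fact (2 * k)"
proof (induction k)
  case (Suc k)
  have "num_hier (Suc (Suc k)) = num_hier (Suc k) * (2 * k + 1)"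
    by (simp add: num_hier_def prod.atLeastLessThan_Suc)
  then have "num_hier (Suc (Suc k)) * fact (Suc k) * 2 ^ Suc k =
      num_hier (Suc k) * (2 * k + 1) * (Suc k * fact k) * (2 * 2 ^ k)"
    by (simp only: fact_Suc power_Suc of_nat_id)
  also have "\<dots> = (num_hier (Suc k) * fact k * 2 ^ k) * ((2 * k + 1) * (2 * Suc k))"
    by (simp only: mult_ac)
  also have "\<dots> = fact (2 * k) * ((2 * k + 1) * (2 * Suc k))" by (simp only: Suc.IH)
  also have "\<dots> = fact (2 * Suc k)" by (simp add: algebra_simps)
  finally show ?case .
qed (simp add: num_hier_def)

text \<open>One term of the exponential series. For \<open>x = m\<close> this is the lower half of Stirling's formula,
  \<open>m! \<ge> (m / e)\<^sup>m\<close>, which is precise enough because the base \<open>e\<close> alone determines the constant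
  in the theorem.\<close>

lemma power_le_exp_fact:
  fixes x :: real
  assumes "0 \<le> x" shows "x ^ m \<le> exp x * fact m"
proof -
  have "(\<Sum>i\<in>{m}. inverse (fact i) * x ^ i) \<le> (\<Sum>i. inverse (fact i) * x ^ i)"
    using assms by (intro sum_le_suminf summable_exp) auto
  then show ?thesis by (simp add: exp_def scaleR_conv_of_real field_simps)
qed

lemma term_bound:
  assumes "1 \<le> k"
  shows "real (n choose k) / real (num_hier k) \<le>
    2 * real k * (real n * (exp 1)\<^sup>2 / (2 * (real k)\<^sup>2)) ^ k"
proof -
  have N: "num_hier (Suc k) = num_hier k * (2 * k - 1)"
    using assms by (simp add: num_hier_def prod.atLeastLessThan_Suc)
  have pos: "real (num_hier k) > 0" using num_hier_pos by simp
  have c: "real (n choose k) * fact k \<le> real n ^ k"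
    using of_nat_mono[OF binomial_fact_pow[of n k], where 'a = real] by simp
  have "real (num_hier k) * (2 * real k) * fact k * 2 ^ k \<ge>
      real (num_hier (Suc k) * fact k * 2 ^ k)"
    using pos assms unfolding N by (simp add: of_nat_diff mult_left_mono)
  then have f: "fact (2 * k) \<le> real (num_hier k) * (2 * real k) * fact k * 2 ^ k"
    unfolding num_hier_fact by simp
  have e: "(2 * real k) ^ (2 * k) \<le> exp 1 ^ (2 * k) * fact (2 * k)"
    using power_le_exp_fact[of "2 * real k" "2 * k"] exp_of_nat_mult[of "2 * k" "1::real"] by simp
  have "real (n choose k) * (2 * real k) ^ (2 * k) * fact k
      \<le> real n ^ k * (exp 1 ^ (2 * k) * fact (2 * k))"
    using mult_mono[OF c e] by (simp add: algebra_simps)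
  also have "\<dots> \<le> real n ^ k * (exp 1 ^ (2 * k) * (real (num_hier k) * (2 * real k) * fact k * 2 ^ k))"
    using f by (intro mult_left_mono) auto
  finally have "(real (n choose k) * (2 * real k) ^ (2 * k)) * fact k \<le>
      (real (num_hier k) * (2 * real k) * (real n ^ k * exp 1 ^ (2 * k) * 2 ^ k)) * fact k"
    by (simp add: algebra_simps)
  then have main: "real (n choose k) * (2 * real k) ^ (2 * k) \<le>
      real (num_hier k) * (2 * real k) * (real n ^ k * exp 1 ^ (2 * k) * 2 ^ k)"
    by (rule mult_right_le_imp_le) simp
  have q: "(real n * (exp 1)\<^sup>2 / (2 * (real k)\<^sup>2)) ^ k =
      real n ^ k * exp 1 ^ (2 * k) * 2 ^ k / (2 * real k) ^ (2 * k)"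
  proof -
    have "real n * (exp 1)\<^sup>2 / (2 * (real k)\<^sup>2) = real n * (exp 1)\<^sup>2 * 2 / (2 * real k)\<^sup>2"
      by (simp add: power2_eq_square)
    then show ?thesis by (simp only: power_divide power_mult_distrib power_mult)
  qed
  have "(2 * real k) ^ (2 * k) > 0" using assms by simp
  then show ?thesis unfolding q using main pos by (simp add: field_simps)
qed

lemma tail_bound:
  fixes q :: real
  assumes "0 \<le> q" "q < 1" "filterlim t at_top sequentially"
  shows "(\<lambda>n. \<Sum>k | k < n \<and> t n < real k. 2 * real (Suc k) * q ^ k) \<longlonglongrightarrow> 0"
proof -
  let ?f = "\<lambda>k. 2 * real (Suc k) * q ^ k"
  have "summable (\<lambda>k. real (Suc k) * q ^ k)"
    using geometric_deriv_sums[of q] assms by (simp add: sums_iff)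
  from summable_mult[OF this, of 2] have sf: "summable ?f" by (simp only: mult.assoc)
  have nonneg: "0 \<le> ?f k" for k using assms(1) by simp
  \<comment> \<open>The indices beyond \<open>t n\<close> are disjoint from the first \<open>m n\<close> ones.\<close>
  define m where "m n = nat \<lfloor>t n\<rfloor>" for n
  have "filterlim m at_top sequentially"
    unfolding m_def
    by (rule filterlim_compose[OF filterlim_nat_sequentially])
      (rule filterlim_compose[OF filterlim_floor_sequentially assms(3)])
  then have "(\<lambda>n. sum ?f {..<m n}) \<longlonglongrightarrow> suminf ?f"
    using filterlim_compose[OF summable_LIMSEQ[OF sf]] by blast
  then have lim: "(\<lambda>n. suminf ?f - sum ?f {..<m n}) \<longlonglongrightarrow> suminf ?f - suminf ?f"
    by (intro tendsto_diff tendsto_const)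
  show ?thesis
  proof (rule tendsto_sandwich[OF _ _ tendsto_const])
    show "(\<lambda>n. suminf ?f - sum ?f {..<m n}) \<longlonglongrightarrow> 0" using lim by simp
    show "\<forall>\<^sub>F n in sequentially. 0 \<le> (\<Sum>k | k < n \<and> t n < real k. ?f k)"
      using nonneg by (intro always_eventually allI sum_nonneg)
    have "(\<Sum>k | k < n \<and> t n < real k. ?f k) \<le> suminf ?f - sum ?f {..<m n}" for n
    proof -
      let ?A = "{k. k < n \<and> t n < real k}"
      have "sum ?f ?A + sum ?f {..<m n} = sum ?f (?A \<union> {..<m n})"
        by (rule sum.union_disjoint[symmetric]) (auto simp: m_def, linarith)
      also have "\<dots> \<le> suminf ?f" using sf nonneg by (intro sum_le_suminf) auto
      finally show ?thesis by simp
    qed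
    then show "\<forall>\<^sub>F n in sequentially. (\<Sum>k | k < n \<and> t n < real k. ?f k) \<le>
        suminf ?f - sum ?f {..<m n}" by simp
  qed
qed

theorem mainTheorem2:
  fixes lstar :: "nat \<Rightarrow> nat set \<Rightarrow> nat" and \<epsilon> :: real
  assumes "\<And>n S. S \<subseteq> {1..n} \<Longrightarrow> 1 < card S \<Longrightarrow> card S < n \<Longrightarrow> lstar n S \<in> {1..n} - S"
    and "\<epsilon> > 0"
  shows "(\<lambda>n. measure_pmf.prob (pair_pmf (uniform_tree n) (uniform_tree n))
            {(T', T''). real (max_common_subtree (lstar n) n T' T'')
               \<le> (1 + \<epsilon>) * exp 1 * 2 powr (-1/2) * real n powr (1/2)})
         \<longlonglongrightarrow> 1"
proof -
  define t where "t n = (1 + \<epsilon>) * exp 1 * 2 powr (-1/2) * real n powr (1/2)" for n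
  define q where "q = 1 / (1 + \<epsilon>)\<^sup>2"
  let ?p = "\<lambda>n. measure_pmf.prob (pair_pmf (uniform_tree n) (uniform_tree n))"
  let ?M = "\<lambda>n T' T''. real (max_common_subtree (lstar n) n T' T'')"
  have q: "0 \<le> q" "q < 1" using assms(2) by (auto simp: q_def one_less_power)
  have c: "(1 + \<epsilon>) * exp 1 * 2 powr (-1/2) > 0" using assms(2) by simp
  have tlim: "filterlim t at_top sequentially"
    unfolding t_def using c by real_asymp
  have t2: "(t n)\<^sup>2 = (1 + \<epsilon>)\<^sup>2 * (exp 1)\<^sup>2 * real n / 2" for n
  proof -
    have "(2 powr (-1/2))\<^sup>2 = (1/2::real)" "(real n powr (1/2))\<^sup>2 = real n"
      by (simp_all add: power2_eq_square powr_add[symmetric] powr_minus_divide)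
    then show ?thesis by (simp add: t_def power_mult_distrib)
  qed
  have bound: "?p n {(T', T''). ?M n T' T'' > t n} \<le>
      (\<Sum>k | k < n \<and> t n < real k. 2 * real (Suc k) * q ^ k)" if "1 \<le> t n" for n
  proof -
    have "?p n {(T', T''). ?M n T' T'' > t n} \<le>
        (\<Sum>k | k < n \<and> t n < real k. real (n choose k) / real (num_hier k))"
      using assms(1) that by (intro prob_large_common_subtree) blast+
    also have "\<dots> \<le> (\<Sum>k | k < n \<and> t n < real k. 2 * real (Suc k) * q ^ k)"
    proof (rule sum_mono)
      fix k assume "k \<in> {k. k < n \<and> t n < real k}"
      then have k: "t n < real k" "1 \<le> k" using that by auto
      then have "(t n)\<^sup>2 \<le> (real k)\<^sup>2" using that by (intro power_mono) auto
      then have "real n * (exp 1)\<^sup>2 / (2 * (real k)\<^sup>2) \<le> q"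
        using k assms(2) unfolding t2 q_def by (simp add: field_simps)
      then have "(real n * (exp 1)\<^sup>2 / (2 * (real k)\<^sup>2)) ^ k \<le> q ^ k"
        by (intro power_mono) auto
      then have "2 * real k * (real n * (exp 1)\<^sup>2 / (2 * (real k)\<^sup>2)) ^ k \<le> 2 * real (Suc k) * q ^ k"
        using q by (intro mult_mono) auto
      then show "real (n choose k) / real (num_hier k) \<le> 2 * real (Suc k) * q ^ k"
        using term_bound[OF k(2)] by (rule order_trans[rotated])
    qed
    finally show ?thesis .
  qed
  have ev: "\<forall>\<^sub>F n in sequentially. 1 \<le> t n"
    using tlim by (auto simp: filterlim_at_top)
  have bad: "(\<lambda>n. ?p n {(T', T''). ?M n T' T'' > t n}) \<longlonglongrightarrow> 0"
  proof (rule tendsto_sandwich[OF _ _ tendsto_const tail_bound[OF q tlim]])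
    show "\<forall>\<^sub>F n in sequentially. ?p n {(T', T''). ?M n T' T'' > t n} \<le>
        (\<Sum>k | k < n \<and> t n < real k. 2 * real (Suc k) * q ^ k)"
      using ev by eventually_elim (rule bound)
  qed simp
  have "?p n {(T', T''). ?M n T' T'' \<le> t n} = 1 - ?p n {(T', T''). ?M n T' T'' > t n}" for n
  proof -
    have "{(T', T''). ?M n T' T'' \<le> t n} = UNIV - {(T', T''). ?M n T' T'' > t n}" by auto
    then show ?thesis
      using measure_pmf.prob_compl[of "{(T', T''). ?M n T' T'' > t n}"] by simp
  qed
  then have "(\<lambda>n. ?p n {(T', T''). ?M n T' T'' \<le> t n}) \<longlonglongrightarrow> 1 - 0"
    using tendsto_diff[OF tendsto_const bad] by simp
  then show ?thesis by (simp add: t_def)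
qed

end
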